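(* Let $(M_1,J,g_1)$ be an almost Hermitian manifold with fundamental 2-form $\Phi_1$, carrying a 1-form $\omega$ with $d\omega=\Phi_1$, and let $(M_2,\phi,\xi,\eta,g_2)$ be a contact metric manifold. Let $\alpha\in\mathbb{R}$, let $f\in C^\infty(M_1,\mathbb{R})$ be positive, and equip $M=M_1\times M_2$ with $\bar\eta(X_1,X_2)=\alpha\,\omega(X_1)+\eta(X_2)$ and the metric $$g\bigl((X_1,X_2),(Y_1,Y_2)\bigr)=g_1(X_1,Y_1)+f^2\bigl(g_2(X_2,Y_2)-\eta(X_2)\eta(Y_2)\bigr)+\bar\eta(X_1,X_2)\,\bar\eta(Y_1,Y_2),$$ with Levi-Civita connection $\nabla$. Then for all $X\in\chi(M_1)$ and $U\in\chi(M_2)$, $$\nabla_{(X,0)}(0,U)=\nabla_{(0,U)}(X,0)=\Bigl(-\alpha\,\eta(U)\,JX,\ -\frac{X[f]}{f}\,\phi^2(U)-\frac{\alpha}{f^2}\,\omega(X)\,\phi(U)+\alpha^2\,\eta(U)\,\omega(JX)\,\xi\Bigr).$$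
   Context: An almost Hermitian manifold $(M_1,J,g_1)$ has $J^2=-\mathrm{id}$ and $g_1(JX,JY)=g_1(X,Y)$; its fundamental 2-form is $\Phi_1(X,Y)=g_1(X,JY)$. The exterior derivative of a 1-form is normalized by $2\,d\eta(X,Y)=X\eta(Y)-Y\eta(X)-\eta([X,Y])$. Vector fields on the product are written $(X_1,X_2)$ with $X_1$ tangent to $M_1$ and $X_2$ tangent to $M_2$; $X[f]$ is the derivative of $f$ along $X$. A contact metric manifold $(M_2,\phi,\xi,\eta,g_2)$ is an odd-dimensional manifold with a $(1,1)$-tensor field $\phi$, a vector field $\xi$, a 1-form $\eta$ and a Riemannian metric $g_2$ satisfying $\phi^2U=-U+\eta(U)\xi$, $\eta(\xi)=1$, $g_2(\phi U,\phi V)=g_2(U,V)-\eta(U)\eta(V)$ and $d\eta(U,V)=g_2(U,\phi V)$ for all $U,V\in\chi(M_2)$. *)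

theory Defs
  imports "HOL-Analysis.Analysis" "HOL-Library.Function_Algebras"
begin

text \<open>Addition and zero of functions are pointwise by \<^theory>\<open>HOL-Library.Function_Algebras\<close>; we add
  pointwise scaling.  It is used for tangent vectors, which are functionals on real-valued
  functions.\<close>

instantiation "fun" :: (type, real_vector) real_vector
begin

definition scaleR_fun :: "real \<Rightarrow> ('a \<Rightarrow> 'b) \<Rightarrow> 'a \<Rightarrow> 'b"
  where "scaleR_fun c F = (\<lambda>x. c *\<^sub>R F x)"

instance
  by standard (simp_all add: scaleR_fun_def fun_eq_iff scaleR_add_right scaleR_add_left)

end

text \<open>Continuous differentiability of order \<open>k\<close>; meaningful for open \<open>S\<close> only.\<close>

primrec Ck_on ::
  "nat \<Rightarrow> 'e::euclidean_space set \<Rightarrow> ('e \<Rightarrow> 'f::real_normed_vector) \<Rightarrow> bool" where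
  "Ck_on 0 S f \<longleftrightarrow> continuous_on S f"
| "Ck_on (Suc k) S f \<longleftrightarrow>
     f differentiable_on S \<and> (\<forall>v. Ck_on k S (\<lambda>x. frechet_derivative f (at x) v))"

definition Cinf_on ::
  "'e::euclidean_space set \<Rightarrow> ('e \<Rightarrow> 'f::real_normed_vector) \<Rightarrow> bool" where
  "Cinf_on S f \<longleftrightarrow> (\<forall>k. Ck_on k S f)"

text \<open>A chart is given by its domain and its coordinate map; the values of the coordinate map
  outside the domain are irrelevant.  The manifold itself is the whole point type, so that the
  product of two manifolds lives on the product type with its product topology.\<close>

type_synonym ('a, 'e) atlas = "('a set \<times> ('a \<Rightarrow> 'e)) set"

definition is_chart ::
  "'a::topological_space set \<Rightarrow> ('a \<Rightarrow> 'e::euclidean_space) \<Rightarrow> bool" where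
  "is_chart D c \<longleftrightarrow> open D \<and> open (c ` D) \<and> homeomorphism D (c ` D) c (inv_into D c)"

locale smooth_manifold =
  fixes A :: "('a::{t2_space, second_countable_topology}, 'e::euclidean_space) atlas"
  assumes charts: "(D, c) \<in> A \<Longrightarrow> is_chart D c"
    and covers: "(\<Union>(D, c)\<in>A. D) = UNIV"
    and compatible: "\<lbrakk>(D, c) \<in> A; (D', c') \<in> A\<rbrakk> \<Longrightarrow> Cinf_on (c ` (D \<inter> D')) (c' \<circ> inv_into D c)"

definition prod_atlas ::
  "('a, 'e) atlas \<Rightarrow> ('b, 'f) atlas \<Rightarrow> ('a \<times> 'b, 'e \<times> 'f) atlas" where
  "prod_atlas A B = {(D \<times> D', map_prod c c') | D c D' c'. (D, c) \<in> A \<and> (D', c') \<in> B}"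

definition smooth_functions ::
  "('a::topological_space, 'e::euclidean_space) atlas \<Rightarrow> ('a \<Rightarrow> real) set" where
  "smooth_functions A = {h. \<forall>(D, c)\<in>A. Cinf_on (c ` D) (h \<circ> inv_into D c)}"

text \<open>A tangent vector at \<open>p\<close> is a derivation at \<open>p\<close> of the algebra of smooth functions.  It is set to
  \<open>0\<close> on all other functions, so that equality of tangent vectors is equality of functionals.
  For a vector field \<open>X\<close>, the derivative of \<open>h\<close> along \<open>X\<close> at \<open>p\<close> is thus \<open>X p h\<close>.\<close>

type_synonym 'a tvec = "('a \<Rightarrow> real) \<Rightarrow> real"

definition tangent_space ::
  "('a::topological_space, 'e::euclidean_space) atlas \<Rightarrow> 'a \<Rightarrow> 'a tvec set" where
  "tangent_space A p = {v.
     (\<forall>h. h \<notin> smooth_functions A \<longrightarrow> v h = 0) \<and>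
     (\<forall>h\<in>smooth_functions A. \<forall>k\<in>smooth_functions A. \<forall>a b.
        v (\<lambda>x. a * h x + b * k x) = a * v h + b * v k) \<and>
     (\<forall>h\<in>smooth_functions A. \<forall>k\<in>smooth_functions A.
        v (\<lambda>x. h x * k x) = v h * k p + h p * v k)}"

definition vector_fields ::
  "('a::topological_space, 'e::euclidean_space) atlas \<Rightarrow> ('a \<Rightarrow> 'a tvec) set" where
  "vector_fields A = {X. (\<forall>p. X p \<in> tangent_space A p) \<and>
     (\<forall>h\<in>smooth_functions A. (\<lambda>p. X p h) \<in> smooth_functions A)}"

definition lie_bracket ::
  "('a \<Rightarrow> 'a tvec) \<Rightarrow> ('a \<Rightarrow> 'a tvec) \<Rightarrow> 'a \<Rightarrow> 'a tvec" where
  "lie_bracket X Y = (\<lambda>p h. X p (\<lambda>q. Y q h) - Y p (\<lambda>q. X q h))"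

text \<open>Tensor fields are pointwise multilinear on the tangent spaces, and smooth in the sense that
  they map smooth vector fields to smooth functions or smooth vector fields.\<close>

definition linear_over :: "'v::real_vector set \<Rightarrow> ('v \<Rightarrow> 'w::real_vector) \<Rightarrow> bool" where
  "linear_over S F \<longleftrightarrow>
     (\<forall>v\<in>S. \<forall>w\<in>S. \<forall>a b. F (a *\<^sub>R v + b *\<^sub>R w) = a *\<^sub>R F v + b *\<^sub>R F w)"

definition one_form ::
  "('a::topological_space, 'e::euclidean_space) atlas \<Rightarrow> ('a \<Rightarrow> 'a tvec \<Rightarrow> real) \<Rightarrow> bool" where
  "one_form A \<omega> \<longleftrightarrow> (\<forall>p. linear_over (tangent_space A p) (\<omega> p)) \<and>
     (\<forall>X\<in>vector_fields A. (\<lambda>p. \<omega> p (X p)) \<in> smooth_functions A)"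

definition endomorphism_field ::
  "('a::topological_space, 'e::euclidean_space) atlas \<Rightarrow> ('a \<Rightarrow> 'a tvec \<Rightarrow> 'a tvec) \<Rightarrow> bool" where
  "endomorphism_field A J \<longleftrightarrow>
     (\<forall>p. J p ` tangent_space A p \<subseteq> tangent_space A p \<and> linear_over (tangent_space A p) (J p)) \<and>
     (\<forall>X\<in>vector_fields A. (\<lambda>p. J p (X p)) \<in> vector_fields A)"

definition riemannian_metric ::
  "('a::topological_space, 'e::euclidean_space) atlas
     \<Rightarrow> ('a \<Rightarrow> 'a tvec \<Rightarrow> 'a tvec \<Rightarrow> real) \<Rightarrow> bool" where
  "riemannian_metric A g \<longleftrightarrow>
     (\<forall>p. \<forall>v\<in>tangent_space A p. linear_over (tangent_space A p) (g p v)) \<and>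
     (\<forall>p. \<forall>v\<in>tangent_space A p. \<forall>w\<in>tangent_space A p. g p v w = g p w v) \<and>
     (\<forall>p. \<forall>v\<in>tangent_space A p. v \<noteq> 0 \<longrightarrow> g p v v > 0) \<and>
     (\<forall>X\<in>vector_fields A. \<forall>Y\<in>vector_fields A. (\<lambda>p. g p (X p) (Y p)) \<in> smooth_functions A)"

text \<open>Exterior derivative of a one-form, in the normalization with the factor one half.\<close>

definition ext_deriv ::
  "('a \<Rightarrow> 'a tvec \<Rightarrow> real) \<Rightarrow> ('a \<Rightarrow> 'a tvec) \<Rightarrow> ('a \<Rightarrow> 'a tvec) \<Rightarrow> 'a \<Rightarrow> real" where
  "ext_deriv \<omega> X Y p =
     (X p (\<lambda>q. \<omega> q (Y q)) - Y p (\<lambda>q. \<omega> q (X q)) - \<omega> p (lie_bracket X Y p)) / 2"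

locale almost_hermitian_manifold = smooth_manifold A
  for A :: "('a::{t2_space, second_countable_topology}, 'e::euclidean_space) atlas" +
  fixes J :: "'a \<Rightarrow> 'a tvec \<Rightarrow> 'a tvec"
    and g :: "'a \<Rightarrow> 'a tvec \<Rightarrow> 'a tvec \<Rightarrow> real"
  assumes J: "endomorphism_field A J"
    and g: "riemannian_metric A g"
    and J_J: "X \<in> vector_fields A \<Longrightarrow> J p (J p (X p)) = - X p"
    and g_J_J: "\<lbrakk>X \<in> vector_fields A; Y \<in> vector_fields A\<rbrakk>
      \<Longrightarrow> g p (J p (X p)) (J p (Y p)) = g p (X p) (Y p)"

definition fundamental_form ::
  "('a \<Rightarrow> 'a tvec \<Rightarrow> 'a tvec) \<Rightarrow> ('a \<Rightarrow> 'a tvec \<Rightarrow> 'a tvec \<Rightarrow> real)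
     \<Rightarrow> 'a \<Rightarrow> 'a tvec \<Rightarrow> 'a tvec \<Rightarrow> real" where
  "fundamental_form J g p v w = g p v (J p w)"

locale contact_metric_manifold = smooth_manifold A
  for A :: "('a::{t2_space, second_countable_topology}, 'e::euclidean_space) atlas" +
  fixes \<phi> :: "'a \<Rightarrow> 'a tvec \<Rightarrow> 'a tvec"
    and \<xi> :: "'a \<Rightarrow> 'a tvec"
    and \<eta> :: "'a \<Rightarrow> 'a tvec \<Rightarrow> real"
    and g :: "'a \<Rightarrow> 'a tvec \<Rightarrow> 'a tvec \<Rightarrow> real"
  assumes odd_dim: "odd DIM('e)"
    and \<phi>: "endomorphism_field A \<phi>"
    and \<xi>: "\<xi> \<in> vector_fields A"
    and \<eta>: "one_form A \<eta>"
    and g: "riemannian_metric A g"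
    and \<phi>_\<phi>: "U \<in> vector_fields A \<Longrightarrow> \<phi> p (\<phi> p (U p)) = - U p + \<eta> p (U p) *\<^sub>R \<xi> p"
    and \<eta>_\<xi>: "\<eta> p (\<xi> p) = 1"
    and g_\<phi>_\<phi>: "\<lbrakk>U \<in> vector_fields A; V \<in> vector_fields A\<rbrakk>
      \<Longrightarrow> g p (\<phi> p (U p)) (\<phi> p (V p)) = g p (U p) (V p) - \<eta> p (U p) * \<eta> p (V p)"
    and d_\<eta>: "\<lbrakk>U \<in> vector_fields A; V \<in> vector_fields A\<rbrakk>
      \<Longrightarrow> ext_deriv \<eta> U V p = g p (U p) (\<phi> p (V p))"

definition affine_connection ::
  "('a::topological_space, 'e::euclidean_space) atlas
     \<Rightarrow> (('a \<Rightarrow> 'a tvec) \<Rightarrow> ('a \<Rightarrow> 'a tvec) \<Rightarrow> ('a \<Rightarrow> 'a tvec)) \<Rightarrow> bool" where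
  "affine_connection A nabla \<longleftrightarrow>
     (\<forall>X\<in>vector_fields A. \<forall>Y\<in>vector_fields A. nabla X Y \<in> vector_fields A) \<and>
     (\<forall>X\<in>vector_fields A. \<forall>Y\<in>vector_fields A. \<forall>Z\<in>vector_fields A.
        nabla (X + Y) Z = nabla X Z + nabla Y Z \<and> nabla X (Y + Z) = nabla X Y + nabla X Z) \<and>
     (\<forall>h\<in>smooth_functions A. \<forall>X\<in>vector_fields A. \<forall>Y\<in>vector_fields A.
        nabla (\<lambda>p. h p *\<^sub>R X p) Y = (\<lambda>p. h p *\<^sub>R nabla X Y p) \<and>
        nabla X (\<lambda>p. h p *\<^sub>R Y p) = (\<lambda>p. X p h *\<^sub>R Y p + h p *\<^sub>R nabla X Y p))"

definition levi_civita_connection ::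
  "('a::topological_space, 'e::euclidean_space) atlas
     \<Rightarrow> ('a \<Rightarrow> 'a tvec \<Rightarrow> 'a tvec \<Rightarrow> real)
     \<Rightarrow> (('a \<Rightarrow> 'a tvec) \<Rightarrow> ('a \<Rightarrow> 'a tvec) \<Rightarrow> ('a \<Rightarrow> 'a tvec)) \<Rightarrow> bool" where
  "levi_civita_connection A g nabla \<longleftrightarrow> affine_connection A nabla \<and>
     (\<forall>X\<in>vector_fields A. \<forall>Y\<in>vector_fields A. nabla X Y - nabla Y X = lie_bracket X Y) \<and>
     (\<forall>X\<in>vector_fields A. \<forall>Y\<in>vector_fields A. \<forall>Z\<in>vector_fields A. \<forall>p.
        X p (\<lambda>q. g q (Y q) (Z q)) = g p (nabla X Y p) (Z p) + g p (Y p) (nabla X Z p))"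

text \<open>The tangent vector \<open>(v, w)\<close> at \<open>(p, q)\<close> under the splitting of the tangent space of the product,
  and the components of an arbitrary tangent vector of the product, that is, its images under the
  differentials of the two projections.  The case distinctions only take care of the convention
  that tangent vectors vanish on non-smooth functions.\<close>

definition pair_tvec ::
  "('a::topological_space, 'e::euclidean_space) atlas
     \<Rightarrow> ('b::topological_space, 'f::euclidean_space) atlas
     \<Rightarrow> 'a \<times> 'b \<Rightarrow> 'a tvec \<Rightarrow> 'b tvec \<Rightarrow> ('a \<times> 'b) tvec" where
  "pair_tvec A B = (\<lambda>(p, q) v w h.
     if h \<in> smooth_functions (prod_atlas A B) then v (\<lambda>x. h (x, q)) + w (\<lambda>y. h (p, y)) else 0)"

definition fst_tvec ::
  "('a::topological_space, 'e::euclidean_space) atlas \<Rightarrow> ('a \<times> 'b) tvec \<Rightarrow> 'a tvec" where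
  "fst_tvec A v = (\<lambda>h. if h \<in> smooth_functions A then v (h \<circ> fst) else 0)"

definition snd_tvec ::
  "('b::topological_space, 'f::euclidean_space) atlas \<Rightarrow> ('a \<times> 'b) tvec \<Rightarrow> 'b tvec" where
  "snd_tvec B v = (\<lambda>h. if h \<in> smooth_functions B then v (h \<circ> snd) else 0)"

definition pair_field ::
  "('a::topological_space, 'e::euclidean_space) atlas
     \<Rightarrow> ('b::topological_space, 'f::euclidean_space) atlas
     \<Rightarrow> ('a \<Rightarrow> 'a tvec) \<Rightarrow> ('b \<Rightarrow> 'b tvec) \<Rightarrow> ('a \<times> 'b \<Rightarrow> ('a \<times> 'b) tvec)" where
  "pair_field A B X Y = (\<lambda>(p, q). pair_tvec A B (p, q) (X p) (Y q))"

definition eta_bar ::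
  "('a::topological_space, 'e::euclidean_space) atlas
     \<Rightarrow> ('b::topological_space, 'f::euclidean_space) atlas
     \<Rightarrow> real \<Rightarrow> ('a \<Rightarrow> 'a tvec \<Rightarrow> real) \<Rightarrow> ('b \<Rightarrow> 'b tvec \<Rightarrow> real)
     \<Rightarrow> 'a \<times> 'b \<Rightarrow> ('a \<times> 'b) tvec \<Rightarrow> real" where
  "eta_bar A B \<alpha> \<omega> \<eta> = (\<lambda>(p, q) v. \<alpha> * \<omega> p (fst_tvec A v) + \<eta> q (snd_tvec B v))"

definition product_metric ::
  "('a::topological_space, 'e::euclidean_space) atlas
     \<Rightarrow> ('b::topological_space, 'f::euclidean_space) atlas
     \<Rightarrow> real \<Rightarrow> ('a \<Rightarrow> real) \<Rightarrow> ('a \<Rightarrow> 'a tvec \<Rightarrow> real)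
     \<Rightarrow> ('a \<Rightarrow> 'a tvec \<Rightarrow> 'a tvec \<Rightarrow> real)
     \<Rightarrow> ('b \<Rightarrow> 'b tvec \<Rightarrow> real) \<Rightarrow> ('b \<Rightarrow> 'b tvec \<Rightarrow> 'b tvec \<Rightarrow> real)
     \<Rightarrow> 'a \<times> 'b \<Rightarrow> ('a \<times> 'b) tvec \<Rightarrow> ('a \<times> 'b) tvec \<Rightarrow> real" where
  "product_metric A B \<alpha> f \<omega> g\<^sub>1 \<eta> g\<^sub>2 = (\<lambda>(p, q) v w.
     g\<^sub>1 p (fst_tvec A v) (fst_tvec A w)
     + (f p)\<^sup>2 * (g\<^sub>2 q (snd_tvec B v) (snd_tvec B w)
                - \<eta> q (snd_tvec B v) * \<eta> q (snd_tvec B w))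
     + eta_bar A B \<alpha> \<omega> \<eta> (p, q) v * eta_bar A B \<alpha> \<omega> \<eta> (p, q) w)"

end

theory Submission
  imports Defs
begin

text \<open>Write \<open>N\<close> for the connection term and subtract the claimed value \<open>P\<close>.  Koszul's formula, applied to the
  fields \<open>(X, 0)\<close>, \<open>(0, U)\<close> and a third field \<open>(Y, 0)\<close> or \<open>(0, V)\<close>, gives the inner products of \<open>N\<close> with
  \<open>(Y, 0)\<close> and \<open>(0, V)\<close>, and \<open>P\<close> has the same ones.  Taking for \<open>Y\<close> and \<open>V\<close> the components of \<open>N - P\<close>
  restricted to the slices through the given point, which are vector fields of the factors, yields
  that \<open>N - P\<close> has length zero there, without any extension of tangent vectors.

  The metric only sees the two components of a tangent vector of the product, so one also needs
  that a derivation of the smooth functions on the product vanishes if both components vanish.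
  This follows from Hadamard's lemma and bump functions, as does the smoothness of \<open>(X, 0)\<close> and \<open>(0, U)\<close>.\<close>

section \<open>Smooth functions on open sets\<close>

text \<open>The structure equations for \<open>J\<close>, \<open>\<phi>\<close> and the two metrics,
  as well as d\<omega> = \<Phi>_1 and the formula for d\<eta>, are given for vector fields, so the
  vectors tested against must be values of global fields; hence test fields built from the
  connection itself. The claimed value P satisfies \<eta>bar(P) = 0: its \<xi>-coefficient
  \<alpha>^2 \<eta>(U) \<omega>(JX) cancels what -\<alpha> \<eta>(U) JX contributes. The other terms
  come out of Koszul's formula: d\<omega> gives the JX term, the derivative of f^2 the \<phi>^2
  term, d\<eta> the \<phi> term, and the factor 2 of Koszul cancels the one half in the exterior
  derivative. A tangent vector is a functional on globally defined smooth functions while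
  coordinates live on one chart; cutting off with bump functions bridges the two. The delicate point
  about (X, 0) is that it differentiates x \<mapsto> h(x, q) along X with q fixed, and the
  definition of a vector field on M_1 does not say how the result depends on q.\<close>

lemma Ck_on_cong:
  assumes "open S" "\<And>x. x \<in> S \<Longrightarrow> f x = g x" "Ck_on k S f"
  shows "Ck_on k S g"
  using assms
proof (induction k arbitrary: f g)
  case 0
  then show ?case by (simp cong: continuous_on_cong)
next
  case (Suc k)
  have der: "(g has_derivative frechet_derivative f (at x)) (at x)" if "x \<in> S" for x
  proof -
    have "f differentiable at x"
      using Suc.prems that by (auto simp: differentiable_on_eq_differentiable_at)
    then have "(f has_derivative frechet_derivative f (at x)) (at x)"
      by (simp add: frechet_derivative_works)
    then show ?thesis
      using has_derivative_transform_within_open[OF _ Suc.prems(1) that] Suc.prems(2) by blast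
  qed
  have "g differentiable_on S"
    using der Suc.prems(1) by (auto simp: differentiable_on_eq_differentiable_at differentiable_def)
  moreover have "Ck_on k S (\<lambda>x. frechet_derivative g (at x) v)" for v
    using Suc.IH[OF Suc.prems(1), of "\<lambda>x. frechet_derivative f (at x) v" "\<lambda>x. frechet_derivative g (at x) v"] Suc.prems(3)
      frechet_derivative_at[OF der] by simp
  ultimately show ?case by simp
qed

text \<open>Derivatives are unique, so an explicit candidate may replace
  \<open>frechet_derivative\<close>; each closure property below then reduces to exhibiting
  one.\<close>

lemma Ck_on_SucI:
  assumes "open S" "\<And>x. x \<in> S \<Longrightarrow> (f has_derivative f' x) (at x)"
    and "\<And>v. Ck_on k S (\<lambda>x. f' x v)"
  shows "Ck_on (Suc k) S f"
proof -
  have "f differentiable_on S"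
    using assms by (auto simp: differentiable_on_eq_differentiable_at differentiable_def)
  moreover have "Ck_on k S (\<lambda>x. frechet_derivative f (at x) v)" for v
    using Ck_on_cong[OF assms(1) _ assms(3)[of v], of "\<lambda>x. frechet_derivative f (at x) v"]
      frechet_derivative_at[OF assms(2)] by simp
  ultimately show ?thesis by simp
qed

lemma Ck_on_Suc_has_derivative:
  assumes "open S" "Ck_on (Suc k) S f" "x \<in> S"
  shows "(f has_derivative frechet_derivative f (at x)) (at x)"
  using assms by (simp add: differentiable_on_eq_differentiable_at flip: frechet_derivative_works)

lemma Ck_on_Suc_imp: "Ck_on (Suc k) S f \<Longrightarrow> Ck_on k S f"
proof (induction k arbitrary: f)
  case 0
  then show ?case by (simp add: differentiable_imp_continuous_on)
next
  case (Suc k)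
  then show ?case by (metis Ck_on.simps(2))
qed

lemma Ck_on_imp_continuous_on: "Ck_on k S f \<Longrightarrow> continuous_on S f"
  by (induction k) (use Ck_on_Suc_imp in auto)

lemma Ck_on_subset: "Ck_on k S f \<Longrightarrow> T \<subseteq> S \<Longrightarrow> Ck_on k T f"
  by (induction k arbitrary: f) (auto intro: continuous_on_subset differentiable_on_subset)

text \<open>The iterated derivatives in \<open>Ck_on\<close> are taken at \<open>x\<close> in the
  whole space and depend only on values near \<open>x\<close>, so the neighbourhoods need not be
  related to each other.\<close>

lemma Ck_on_local:
  assumes "open S" "\<And>x. x \<in> S \<Longrightarrow> \<exists>T. open T \<and> x \<in> T \<and> Ck_on k T f"
  shows "Ck_on k S f"
  using assms(2)
proof (induction k arbitrary: f)
  case 0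
  have "continuous (at x) f" if "x \<in> S" for x
    using 0[OF that] by (auto simp: continuous_on_eq_continuous_at)
  then show ?case by (auto simp: continuous_at_imp_continuous_on)
next
  case (Suc k)
  have "f differentiable_on S"
    using Suc.prems assms(1) by (fastforce simp: differentiable_on_eq_differentiable_at)
  moreover have "Ck_on k S (\<lambda>x. frechet_derivative f (at x) v)" for v
    using Suc.IH[of "\<lambda>x. frechet_derivative f (at x) v"] Suc.prems by fastforce
  ultimately show ?case by simp
qed

lemma Ck_on_const: "open S \<Longrightarrow> Ck_on k S (\<lambda>_. c)"
proof (induction k arbitrary: c)
  case (Suc k)
  then show ?case
    by (intro Ck_on_SucI[where f' = "\<lambda>_ _. 0"]) auto
qed simp

lemma Ck_on_bounded_linear_comp:
  assumes "bounded_linear L" "open S" "Ck_on k S f"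
  shows "Ck_on k S (\<lambda>x. L (f x))"
  using assms(3)
proof (induction k arbitrary: f)
  case 0
  then show ?case using assms by (auto intro: bounded_linear.continuous_on)
next
  case (Suc k)
  show ?case
  proof (rule Ck_on_SucI[OF assms(2), where f' = "\<lambda>x v. L (frechet_derivative f (at x) v)"])
    fix x assume "x \<in> S"
    then show "((\<lambda>x. L (f x)) has_derivative (\<lambda>v. L (frechet_derivative f (at x) v))) (at x)"
      using Ck_on_Suc_has_derivative[OF assms(2) Suc.prems] bounded_linear.has_derivative[OF assms(1)]
      by blast
  qed (use Suc in auto)
qed

lemma Ck_on_id:
  assumes "open S" shows "Ck_on k S (\<lambda>x. x)"
proof (cases k)
  case (Suc j)
  show ?thesis unfolding Suc
    by (rule Ck_on_SucI[OF assms, where f' = "\<lambda>_ v. v"]) (auto intro: Ck_on_const assms)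
qed auto

lemma Ck_on_bounded_linear: "bounded_linear L \<Longrightarrow> open S \<Longrightarrow> Ck_on k S L"
  using Ck_on_bounded_linear_comp[OF _ _ Ck_on_id] by blast

lemma Ck_on_add:
  assumes "open S" "Ck_on k S f" "Ck_on k S g"
  shows "Ck_on k S (\<lambda>x. f x + g x)"
  using assms(2,3)
proof (induction k arbitrary: f g)
  case 0
  then show ?case by (auto intro: continuous_intros)
next
  case (Suc k)
  show ?case
    by (rule Ck_on_SucI[OF assms(1), where f' = "\<lambda>x v. frechet_derivative f (at x) v + frechet_derivative g (at x) v"])
      (use Suc Ck_on_Suc_has_derivative[OF assms(1) Suc.prems(1)]
        Ck_on_Suc_has_derivative[OF assms(1) Suc.prems(2)] in \<open>auto intro!: has_derivative_add\<close>)
qed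

lemma Ck_on_sum:
  assumes "open S" "\<And>i. i \<in> I \<Longrightarrow> Ck_on k S (f i)"
  shows "Ck_on k S (\<lambda>x. \<Sum>i\<in>I. f i x)"
  using assms(2)
  by (induction I rule: infinite_finite_induct) (auto intro: Ck_on_const Ck_on_add assms(1))

lemma Ck_on_scaleR:
  assumes "open S" "Ck_on k S h" "Ck_on k S f"
  shows "Ck_on k S (\<lambda>x. h x *\<^sub>R f x)"
  using assms(2,3)
proof (induction k arbitrary: f h)
  case 0
  then show ?case by (auto intro: continuous_intros)
next
  case (Suc k)
  note d = Suc.prems[THEN Ck_on_Suc_has_derivative[OF assms(1)]]
  show ?case
  proof (rule Ck_on_SucI[OF assms(1), where f' = "\<lambda>x v. h x *\<^sub>R frechet_derivative f (at x) v
      + frechet_derivative h (at x) v *\<^sub>R f x"])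
    fix x assume "x \<in> S"
    then show "((\<lambda>x. h x *\<^sub>R f x) has_derivative (\<lambda>v. h x *\<^sub>R frechet_derivative f (at x) v
      + frechet_derivative h (at x) v *\<^sub>R f x)) (at x)"
      by (intro has_derivative_scaleR d)
  next
    fix v
    show "Ck_on k S (\<lambda>x. h x *\<^sub>R frechet_derivative f (at x) v + frechet_derivative h (at x) v *\<^sub>R f x)"
      using Suc.prems by (intro Ck_on_add[OF assms(1)] Suc.IH) (auto intro: Ck_on_Suc_imp)
  qed
qed

text \<open>\<open>Ck_on\<close> differentiates in a fixed direction, but the chain rule evaluates
  the derivative of \<open>f\<close> in a direction that moves with \<open>x\<close>. Expanding this
  direction in the basis turns the derivative into a sum of products, to which the induction
  hypothesis and \<open>Ck_on_scaleR\<close> apply.\<close>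

lemma Ck_on_compose:
  fixes f :: "'b::euclidean_space \<Rightarrow> 'c::real_normed_vector" and g :: "'a::euclidean_space \<Rightarrow> 'b"
  assumes "open S" "open T" "g ` S \<subseteq> T" "Ck_on k T f" "Ck_on k S g"
  shows "Ck_on k S (\<lambda>x. f (g x))"
  using assms(4,5)
proof (induction k arbitrary: f)
  case 0
  then show ?case using assms(3) by (auto intro: continuous_on_compose2)
next
  case (Suc k)
  let ?f' = "\<lambda>x. frechet_derivative f (at x)" and ?g' = "\<lambda>x. frechet_derivative g (at x)"
  have f': "(f has_derivative ?f' (g x)) (at (g x))" if "x \<in> S" for x
    using Ck_on_Suc_has_derivative[OF assms(2) Suc.prems(1)] assms(3) that by auto
  show ?case
  proof (rule Ck_on_SucI[OF assms(1),
        where f' = "\<lambda>x v. \<Sum>b\<in>Basis. (?g' x v \<bullet> b) *\<^sub>R ?f' (g x) b"])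
    fix x assume x: "x \<in> S"
    have "((\<lambda>x. f (g x)) has_derivative (\<lambda>v. ?f' (g x) (?g' x v))) (at x)"
      using Ck_on_Suc_has_derivative[OF assms(1) Suc.prems(2) x] f'[OF x] has_derivative_compose by blast
    also have "(\<lambda>v. ?f' (g x) (?g' x v)) = (\<lambda>v. \<Sum>b\<in>Basis. (?g' x v \<bullet> b) *\<^sub>R ?f' (g x) b)"
      (is "?L = _")
    proof
      fix v
      interpret linear "?f' (g x)"
        using f'[OF x] by (simp add: has_derivative_linear)
      have "?L v = ?f' (g x) (\<Sum>b\<in>Basis. (?g' x v \<bullet> b) *\<^sub>R b)"
        by (simp add: euclidean_representation)
      then show "?L v = (\<Sum>b\<in>Basis. (?g' x v \<bullet> b) *\<^sub>R ?f' (g x) b)"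
        by (simp add: sum scaleR)
    qed
    finally show "((\<lambda>x. f (g x)) has_derivative \<dots>) (at x)" .
  next
    fix v
    show "Ck_on k S (\<lambda>x. \<Sum>b\<in>Basis. (?g' x v \<bullet> b) *\<^sub>R ?f' (g x) b)"
      using Suc.prems
      by (intro Ck_on_sum Ck_on_scaleR Suc.IH Ck_on_bounded_linear_comp[OF bounded_linear_inner_left] assms(1))
        (auto intro: Ck_on_Suc_imp)
  qed
qed

lemma Cinf_on_cong:
  "\<lbrakk>open S; \<And>x. x \<in> S \<Longrightarrow> f x = g x; Cinf_on S f\<rbrakk> \<Longrightarrow> Cinf_on S g"
  unfolding Cinf_on_def using Ck_on_cong by blast

lemma Cinf_on_imp_continuous_on: "Cinf_on S f \<Longrightarrow> continuous_on S f"
  unfolding Cinf_on_def by (meson Ck_on.simps(1))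

lemma Cinf_on_has_derivative:
  "\<lbrakk>open S; Cinf_on S f; x \<in> S\<rbrakk> \<Longrightarrow> (f has_derivative frechet_derivative f (at x)) (at x)"
  unfolding Cinf_on_def using Ck_on_Suc_has_derivative by blast

lemma Cinf_on_frechet_derivative: "Cinf_on S f \<Longrightarrow> Cinf_on S (\<lambda>x. frechet_derivative f (at x) v)"
  unfolding Cinf_on_def by (metis Ck_on.simps(2))

lemma Cinf_on_subset: "Cinf_on S f \<Longrightarrow> T \<subseteq> S \<Longrightarrow> Cinf_on T f"
  unfolding Cinf_on_def using Ck_on_subset by blast

lemma Cinf_on_local:
  "\<lbrakk>open S; \<And>x. x \<in> S \<Longrightarrow> \<exists>T. open T \<and> x \<in> T \<and> Cinf_on T f\<rbrakk> \<Longrightarrow> Cinf_on S f"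
  unfolding Cinf_on_def by (intro allI Ck_on_local) blast+

lemma Cinf_on_const: "open S \<Longrightarrow> Cinf_on S (\<lambda>_. c)"
  unfolding Cinf_on_def by (simp add: Ck_on_const)

lemma Cinf_on_bounded_linear: "bounded_linear L \<Longrightarrow> open S \<Longrightarrow> Cinf_on S L"
  unfolding Cinf_on_def by (simp add: Ck_on_bounded_linear)

lemma Cinf_on_add:
  "\<lbrakk>open S; Cinf_on S f; Cinf_on S g\<rbrakk> \<Longrightarrow> Cinf_on S (\<lambda>x. f x + g x)"
  unfolding Cinf_on_def by (simp add: Ck_on_add)

lemma Cinf_on_sum:
  "\<lbrakk>open S; \<And>i. i \<in> I \<Longrightarrow> Cinf_on S (f i)\<rbrakk> \<Longrightarrow> Cinf_on S (\<lambda>x. \<Sum>i\<in>I. f i x)"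
  unfolding Cinf_on_def by (simp add: Ck_on_sum)

lemma Cinf_on_mult:
  fixes f g :: "'a::euclidean_space \<Rightarrow> real"
  shows "\<lbrakk>open S; Cinf_on S f; Cinf_on S g\<rbrakk> \<Longrightarrow> Cinf_on S (\<lambda>x. f x * g x)"
  unfolding Cinf_on_def using Ck_on_scaleR[of S _ f g] by simp

lemma Cinf_on_compose:
  fixes f :: "'b::euclidean_space \<Rightarrow> 'c::real_normed_vector" and g :: "'a::euclidean_space \<Rightarrow> 'b"
  shows "\<lbrakk>open S; open T; g ` S \<subseteq> T; Cinf_on T f; Cinf_on S g\<rbrakk> \<Longrightarrow> Cinf_on S (\<lambda>x. f (g x))"
  unfolding Cinf_on_def using Ck_on_compose by blast

lemma Cinf_on_bounded_linear_comp:
  "\<lbrakk>bounded_linear L; open S; Cinf_on S f\<rbrakk> \<Longrightarrow> Cinf_on S (\<lambda>x. L (f x))"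
  unfolding Cinf_on_def by (simp add: Ck_on_bounded_linear_comp)

lemma Cinf_on_Pair:
  assumes "open S" "Cinf_on S f" "Cinf_on S g"
  shows "Cinf_on S (\<lambda>x. (f x, g x))"
proof -
  have "bounded_linear (\<lambda>u::'b. (u, 0::'c))" "bounded_linear (\<lambda>u::'c. (0::'b, u))"
    by (auto intro: bounded_linear_Pair bounded_linear_ident bounded_linear_zero)
  then have "Cinf_on S (\<lambda>x. (f x, 0) + (0, g x))"
    using Cinf_on_add[OF assms(1) Cinf_on_bounded_linear_comp[OF _ assms(1,2)]
        Cinf_on_bounded_linear_comp[OF _ assms(1,3)]] by blast
  then show ?thesis by simp
qed

section \<open>Flat functions and bump functions\<close>

definition flat :: "nat \<Rightarrow> real \<Rightarrow> real" where
  "flat n x = (if x > 0 then exp (- inverse x) * inverse x ^ n else 0)"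

lemma flat_tendsto_0: "(flat n \<longlongrightarrow> 0) (at 0)"
proof -
  have "((\<lambda>y::real. y ^ n / exp y) \<longlongrightarrow> 0) at_top"
    by (rule tendsto_power_div_exp_0)
  then have "((\<lambda>x::real. inverse x ^ n / exp (inverse x)) \<longlongrightarrow> 0) (at_right 0)"
    by (rule filterlim_compose[OF _ filterlim_inverse_at_top_right])
  moreover have "\<forall>\<^sub>F x::real in at_right 0. inverse x ^ n / exp (inverse x) = flat n x"
    by (auto simp: eventually_at_filter flat_def exp_minus divide_inverse)
  ultimately have "(flat n \<longlongrightarrow> 0) (at_right 0)"
    by (rule Lim_transform_eventually)
  moreover have "(flat n \<longlongrightarrow> 0) (at_left 0)"
    by (rule tendsto_eventually) (auto simp: eventually_at_filter flat_def)
  ultimately show ?thesis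
    by (simp add: filterlim_split_at)
qed

text \<open>The functions exp(-1/x) x^(-n), extended by 0 to x \<le> 0, are closed under
  differentiation up to linear combinations. This is why \<open>flat\<close> carries the exponent
  \<open>n\<close>: smoothness then follows by induction for all \<open>n\<close> at once.\<close>

lemma flat_has_field_derivative:
  "(flat n has_field_derivative flat (n + 2) x - n * flat (n + 1) x) (at x)"
proof -
  consider "x < 0" | "x = 0" | "x > 0" by linarith
  then show ?thesis
  proof cases
    case 1
    have "((\<lambda>_. 0) has_field_derivative 0) (at x)" by simp
    then have "(flat n has_field_derivative 0) (at x)"
      by (rule has_field_derivative_transform_within_open[where S = "{..<0}"])
        (use 1 in \<open>auto simp: flat_def\<close>)
    then show ?thesis using 1 by (simp add: flat_def)
  next
    case 2
    \<comment> \<open>The difference quotient at 0 is again a member of the family, so its limit is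
      known.\<close>
    have "(flat n y - flat n 0) / (y - 0) = flat (n + 1) y" for y
      by (simp add: flat_def divide_inverse)
    then have "(flat n has_field_derivative 0) (at 0)"
      using flat_tendsto_0[of "n + 1"] by (simp add: has_field_derivative_iff)
    then show ?thesis using 2 by (simp add: flat_def)
  next
    case 3
    have "((\<lambda>x. exp (- inverse x) * inverse x ^ n) has_field_derivative
        exp (- inverse x) * (inverse x)\<^sup>2 * inverse x ^ n
        + (real n * inverse x ^ (n - 1) * (- (inverse x)\<^sup>2)) * exp (- inverse x)) (at x)"
      using 3 by (auto intro!: derivative_eq_intros simp: power2_eq_square)
    moreover have "exp (- inverse x) * (inverse x)\<^sup>2 * inverse x ^ n
        + (real n * inverse x ^ (n - 1) * (- (inverse x)\<^sup>2)) * exp (- inverse x)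
        = flat (n + 2) x - n * flat (n + 1) x"
      using 3 by (cases n) (auto simp: flat_def power2_eq_square algebra_simps)
    ultimately have "((\<lambda>x. exp (- inverse x) * inverse x ^ n) has_field_derivative
        flat (n + 2) x - n * flat (n + 1) x) (at x)"
      by (simp only:)
    then show ?thesis
      by (rule has_field_derivative_transform_within_open[where S = "{0<..}"])
        (use 3 in \<open>auto simp: flat_def\<close>)
  qed
qed

lemma Ck_on_flat: "Ck_on k UNIV (flat n)"
proof (induction k arbitrary: n)
  case 0
  then show ?case
    by (auto simp: continuous_on_eq_continuous_at intro: DERIV_isCont flat_has_field_derivative)
next
  case (Suc k)
  show ?case
  proof (rule Ck_on_SucI)
    show "(flat n has_derivative (*) (flat (n + 2) x + (- real n) * flat (n + 1) x)) (at x)" for x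
      using flat_has_field_derivative[of n x] by (simp add: has_field_derivative_def)
    show "Ck_on k UNIV (\<lambda>x. (flat (n + 2) x + (- real n) * flat (n + 1) x) * v)" for v
      by (intro Ck_on_bounded_linear_comp[OF bounded_linear_mult_left, of UNIV k _ v]
          Ck_on_bounded_linear_comp[OF bounded_linear_mult_right, of UNIV k _ "- real n"] Ck_on_add Suc)
        auto
  qed simp
qed

lemma Cinf_on_flat: "Cinf_on UNIV (flat n)"
  by (simp add: Cinf_on_def Ck_on_flat)

lemma flat_0_mono: "x \<le> y \<Longrightarrow> flat 0 x \<le> flat 0 y"
  by (auto simp: flat_def le_imp_inverse_le)

text \<open>With \<open>F = flat 0\<close>, the function \<open>\<lambda>t. F (F 1 - F t)\<close> is constant and positive for \<open>t \<le> 0\<close>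
  and zero for \<open>t \<ge> 1\<close>; composing it with a quadratic function gives a plateau function.\<close>

lemma exists_bump:
  fixes p :: "'e::euclidean_space"
  assumes "0 < s" "s < r"
  shows "\<exists>\<beta>::'e \<Rightarrow> real. Cinf_on UNIV \<beta> \<and> (\<forall>x\<in>ball p s. \<beta> x = 1) \<and> (\<forall>x. x \<notin> ball p r \<longrightarrow> \<beta> x = 0)"
proof -
  define a where "a = flat 0 1"
  have a: "a > 0" "flat 0 a > 0" by (auto simp: a_def flat_def)
  define c where "c = inverse (r\<^sup>2 - s\<^sup>2)"
  have rs: "s\<^sup>2 < r\<^sup>2" using assms by (simp add: power_strict_mono)
  \<comment> \<open>Affine in the squared distance from \<open>p\<close>, with value 0 at distance
    \<open>s\<close> and 1 at distance \<open>r\<close>; the square keeps it smooth at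
    \<open>p\<close>.\<close>
  define \<tau> :: "'e \<Rightarrow> real" where "\<tau> x = ((x - p) \<bullet> (x - p) - s\<^sup>2) * c" for x
  define \<beta> where "\<beta> x = flat 0 (a + (- 1) * flat 0 (\<tau> x)) * inverse (flat 0 a)" for x
  have "Cinf_on UNIV (\<lambda>x. (x + - p) \<bullet> (x + - p))"
    unfolding euclidean_inner[of "_ + _" "_ + _"]
    by (intro Cinf_on_sum Cinf_on_mult Cinf_on_bounded_linear_comp[OF bounded_linear_inner_left]
        Cinf_on_add Cinf_on_const Cinf_on_bounded_linear[OF bounded_linear_ident]) auto
  then have "Cinf_on UNIV (\<lambda>x. ((x + - p) \<bullet> (x + - p) + - s\<^sup>2) * c)"
    by (intro Cinf_on_mult Cinf_on_add Cinf_on_const) auto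
  then have "Cinf_on UNIV \<tau>" by (simp add: \<tau>_def[abs_def])
  then have "Cinf_on UNIV (\<lambda>x. flat 0 (\<tau> x))"
    by (rule Cinf_on_compose[where T = UNIV, rotated -1]) (auto simp: Cinf_on_flat)
  then have "Cinf_on UNIV (\<lambda>x. a + (- 1) * flat 0 (\<tau> x))"
    by (intro Cinf_on_mult Cinf_on_add Cinf_on_const) auto
  then have "Cinf_on UNIV (\<lambda>x. flat 0 (a + (- 1) * flat 0 (\<tau> x)))"
    by (rule Cinf_on_compose[where T = UNIV, rotated -1]) (auto simp: Cinf_on_flat)
  then have "Cinf_on UNIV \<beta>"
    unfolding \<beta>_def[abs_def] by (intro Cinf_on_mult Cinf_on_const) auto
  moreover have "\<beta> x = 1" if "x \<in> ball p s" for x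
  proof -
    have "(norm (x - p))\<^sup>2 \<le> s\<^sup>2"
      using that by (intro power_mono) (auto simp: dist_norm norm_minus_commute)
    then have "\<tau> x \<le> 0"
      using rs by (auto simp: \<tau>_def c_def power2_norm_eq_inner mult_le_0_iff)
    then have "flat 0 (\<tau> x) = 0" by (simp add: flat_def)
    then show ?thesis using a by (simp add: \<beta>_def)
  qed
  moreover have "\<beta> x = 0" if "x \<notin> ball p r" for x
  proof -
    have "r\<^sup>2 \<le> (norm (x - p))\<^sup>2"
      using that assms by (intro power_mono) (auto simp: dist_norm norm_minus_commute)
    then have "1 \<le> \<tau> x"
      using rs by (simp add: \<tau>_def c_def power2_norm_eq_inner field_simps)
    then have "a \<le> flat 0 (\<tau> x)" unfolding a_def by (rule flat_0_mono)
    then have "flat 0 (a + (- 1) * flat 0 (\<tau> x)) = 0" by (simp add: flat_def)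
    then show ?thesis by (simp add: \<beta>_def)
  qed
  ultimately show ?thesis by blast
qed

section \<open>Hadamard's lemma by integration along segments\<close>

lemma segment_in_convex:
  assumes "convex U" "p \<in> U" "x \<in> U" "t \<in> {0..1::real}"
  shows "p + t *\<^sub>R (x - p) \<in> U"
proof -
  have "(1 - t) *\<^sub>R p + t *\<^sub>R x \<in> U"
    using assms by (auto simp: convex_alt)
  then show ?thesis by (simp add: algebra_simps)
qed

text \<open>The weight \<open>t ^ m\<close> makes the induction close: differentiating F(p + t(x -
  p)) in \<open>x\<close> brings out one factor \<open>t\<close>, so the derivative is a combination
  of integrals of the same shape with \<open>m + 1\<close> and a partial derivative of
  \<open>F\<close>.\<close>

lemma Ck_on_integral_segment:
  fixes F :: "'e::euclidean_space \<Rightarrow> real"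
  assumes "open U" "convex U" "p \<in> U" "Ck_on k U F"
  shows "Ck_on k U (\<lambda>x. integral {0..1} (\<lambda>t. t ^ m * F (p + t *\<^sub>R (x - p))))"
  using assms(4)
proof (induction k arbitrary: F m)
  have cont: "continuous_on (U \<times> cbox 0 1) (\<lambda>(x, t). t ^ m * F (p + t *\<^sub>R (x - p)))"
    if "continuous_on U F" for F :: "'e \<Rightarrow> real" and m
    unfolding case_prod_beta
    by (intro continuous_intros continuous_on_compose2[OF that])
      (auto intro!: segment_in_convex assms)
  {
    case 0
    then show ?case
      using integral_continuous_on_param[OF cont] by simp
  next
    case (Suc k)
    let ?D = "\<lambda>b x. frechet_derivative F (at x) b"
    \<comment> \<open>\<open>leibniz_rule\<close> expects the derivative as a bounded operator that
      depends continuously on (x, t). Assembling it from partial derivatives reduces this to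
      continuity of the matrix entries.\<close>
    let ?fx = "\<lambda>x t. blinfun_of_matrix (\<lambda>_ b. t ^ Suc m * ?D b (p + t *\<^sub>R (x - p))) :: 'e \<Rightarrow>\<^sub>L real"
    have contF: "continuous_on U F" using Ck_on_imp_continuous_on[OF Suc.prems] .
    have contD: "continuous_on U (?D b)" for b
      using Suc.prems Ck_on_imp_continuous_on by (metis Ck_on.simps(2))
    have cfx: "continuous_on (U \<times> cbox 0 1) (\<lambda>(x, t). ?fx x t)"
      using cont[OF contD, of "Suc m"] unfolding case_prod_beta
      by (intro continuous_on_blinfun_of_matrix) auto
    have der: "((\<lambda>x. t ^ m * F (p + t *\<^sub>R (x - p))) has_derivative blinfun_apply (?fx x t)) (at x within U)"
      if "x \<in> U" "t \<in> cbox 0 1" for x t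
    proof -
      let ?y = "p + t *\<^sub>R (x - p)"
      have "?y \<in> U" using that by (auto intro!: segment_in_convex assms)
      then have F: "(F has_derivative frechet_derivative F (at ?y)) (at ?y)"
        using Ck_on_Suc_has_derivative[OF assms(1) Suc.prems] by blast
      then interpret linear "frechet_derivative F (at ?y)" by (simp add: has_derivative_linear)
      have "((\<lambda>x. p + t *\<^sub>R (x - p)) has_derivative (\<lambda>v. t *\<^sub>R v)) (at x within U)"
        by (auto intro!: derivative_eq_intros)
      from has_derivative_compose[OF this F]
      have "((\<lambda>x. t ^ m * F (p + t *\<^sub>R (x - p))) has_derivative
          (\<lambda>v. t ^ m * frechet_derivative F (at ?y) (t *\<^sub>R v))) (at x within U)"
        by (rule has_derivative_mult_right)
      moreover have "t ^ m * frechet_derivative F (at ?y) (t *\<^sub>R v) = blinfun_apply (?fx x t) v" for v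
      proof -
        have "frechet_derivative F (at ?y) v = frechet_derivative F (at ?y) (\<Sum>b\<in>Basis. (v \<bullet> b) *\<^sub>R b)"
          by (simp add: euclidean_representation)
        then have "frechet_derivative F (at ?y) v = (\<Sum>b\<in>Basis. (v \<bullet> b) * ?D b ?y)"
          by (simp add: sum scaleR)
        moreover have "frechet_derivative F (at ?y) (t *\<^sub>R v) = t * frechet_derivative F (at ?y) v"
          by (simp only: scaleR real_scaleR_def)
        ultimately show ?thesis
          by (simp add: blinfun_of_matrix_apply sum_distrib_left algebra_simps)
      qed
      ultimately show ?thesis by simp
    qed
    have int: "(\<lambda>t. t ^ m * F (p + t *\<^sub>R (x - p))) integrable_on cbox 0 1" if "x \<in> U" for x
      by (intro integrable_continuous continuous_intros continuous_on_compose2[OF contF])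
        (use that in \<open>auto intro!: segment_in_convex assms\<close>)
    show ?case
    proof (rule Ck_on_SucI[OF assms(1)])
      fix x assume x: "x \<in> U"
      have "((\<lambda>x. integral (cbox 0 1) (\<lambda>t. t ^ m * F (p + t *\<^sub>R (x - p)))) has_derivative
          blinfun_apply (integral (cbox 0 1) (?fx x))) (at x within U)"
        by (rule leibniz_rule[OF der int cfx x assms(2)])
      then show "((\<lambda>x. integral {0..1} (\<lambda>t. t ^ m * F (p + t *\<^sub>R (x - p)))) has_derivative
          blinfun_apply (integral (cbox 0 1) (?fx x))) (at x)"
        by (simp only: cbox_interval at_within_open[OF x assms(1)])
    next
      fix v
      have eq: "blinfun_apply (integral (cbox 0 1) (?fx x)) v =
          (\<Sum>b\<in>Basis. (v \<bullet> b) * integral {0..1} (\<lambda>t. t ^ Suc m * ?D b (p + t *\<^sub>R (x - p))))"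
        if x: "x \<in> U" for x
      proof -
        have i: "(\<lambda>t. t ^ Suc m * ?D b (p + t *\<^sub>R (x - p))) integrable_on {0..1}" for b
          unfolding cbox_interval[symmetric]
          by (intro integrable_continuous continuous_intros continuous_on_compose2[OF contD])
            (use x in \<open>auto intro!: segment_in_convex assms\<close>)
        have "continuous_on (cbox 0 1) (?fx x)"
          by (rule continuous_on_compose2[OF cfx, where f = "\<lambda>t. (x, t)", unfolded prod.case])
            (use x in \<open>auto intro!: continuous_intros\<close>)
        then have "?fx x integrable_on cbox 0 1" by (rule integrable_continuous)
        then have "blinfun_apply (integral (cbox 0 1) (?fx x)) v = integral (cbox 0 1) (\<lambda>t. blinfun_apply (?fx x t) v)"
          by (rule blinfun_apply_integral)
        also have "\<dots> = integral {0..1} (\<lambda>t. \<Sum>b\<in>Basis. (v \<bullet> b) * (t ^ Suc m * ?D b (p + t *\<^sub>R (x - p))))"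
          by (simp add: blinfun_of_matrix_apply)
        also have "\<dots> = (\<Sum>b\<in>Basis. (v \<bullet> b) * integral {0..1} (\<lambda>t. t ^ Suc m * ?D b (p + t *\<^sub>R (x - p))))"
          using i by (subst integral_sum) (auto intro: integrable_on_mult_right)
        finally show ?thesis .
      qed
      have ck: "Ck_on k U (\<lambda>x. \<Sum>b\<in>Basis. (v \<bullet> b) * integral {0..1} (\<lambda>t. t ^ Suc m * ?D b (p + t *\<^sub>R (x - p))))"
      proof (intro Ck_on_sum[OF assms(1)] Ck_on_bounded_linear_comp[OF bounded_linear_mult_right assms(1)])
        fix b
        have "Ck_on k U (?D b)" using Suc.prems by simp
        from Suc.IH[OF this]
        show "Ck_on k U (\<lambda>x. integral {0..1} (\<lambda>t. t ^ Suc m * ?D b (p + t *\<^sub>R (x - p))))" .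
      qed
      show "Ck_on k U (\<lambda>x. blinfun_apply (integral (cbox 0 1) (?fx x)) v)"
        by (rule Ck_on_cong[OF assms(1) eq[symmetric] ck])
    qed
  }
qed

text \<open>The coefficients are the averages of the partial derivatives over the segment from
  \<open>p\<close> to \<open>x\<close>. The fundamental theorem of calculus along this segment gives
  the expansion, and at x = p the integrand is constant, which gives the values there.\<close>

lemma hadamard:
  fixes F :: "'e::euclidean_space \<Rightarrow> real"
  assumes "open U" "convex U" "p \<in> U" "Cinf_on U F"
  shows "\<exists>a. (\<forall>b. Cinf_on U (a b) \<and> a b p = frechet_derivative F (at p) b) \<and>
    (\<forall>x\<in>U. F x = F p + (\<Sum>b\<in>Basis. ((x - p) \<bullet> b) * a b x))"
proof -
  let ?D = "\<lambda>b x. frechet_derivative F (at x) b"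
  \<comment> \<open>The factor \<open>t ^ 0\<close> brings the integral into the form of
    \<open>Ck_on_integral_segment\<close> with m = 0.\<close>
  define a where "a b x = integral {0..1} (\<lambda>t. t ^ 0 * ?D b (p + t *\<^sub>R (x - p)))" for b x
  have D: "Cinf_on U (?D b)" for b
    using Cinf_on_frechet_derivative[OF assms(4)] .
  have "Cinf_on U (a b)" for b
    using D[of b] unfolding Cinf_on_def a_def
    by (intro allI Ck_on_integral_segment[OF assms(1-3)]) blast
  moreover have "a b p = ?D b p" for b
    by (simp add: a_def)
  moreover have "F x = F p + (\<Sum>b\<in>Basis. ((x - p) \<bullet> b) * a b x)" if x: "x \<in> U" for x
  proof -
    have "((\<lambda>t. F (p + t *\<^sub>R (x - p))) has_vector_derivative
        (\<Sum>b\<in>Basis. ((x - p) \<bullet> b) * ?D b (p + t *\<^sub>R (x - p)))) (at t within {0..1})"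
      if "t \<in> {0..1}" for t
    proof -
      let ?y = "p + t *\<^sub>R (x - p)"
      have "?y \<in> U" using that x by (auto intro!: segment_in_convex assms)
      then have F: "(F has_derivative frechet_derivative F (at ?y)) (at ?y)"
        using Cinf_on_has_derivative[OF assms(1,4)] by blast
      then interpret linear "frechet_derivative F (at ?y)" by (simp add: has_derivative_linear)
      have "((\<lambda>t. p + t *\<^sub>R (x - p)) has_derivative (\<lambda>s. s *\<^sub>R (x - p))) (at t within {0..1})"
        by (auto intro!: derivative_eq_intros)
      from has_derivative_compose[OF this F]
      have "((\<lambda>t. F (p + t *\<^sub>R (x - p))) has_vector_derivative ?D (x - p) ?y) (at t within {0..1})"
        by (simp add: has_vector_derivative_def scaleR)
      moreover have "?D (x - p) ?y = ?D (\<Sum>b\<in>Basis. ((x - p) \<bullet> b) *\<^sub>R b) ?y"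
        by (simp only: euclidean_representation)
      ultimately show ?thesis by (simp only: sum scaleR) simp
    qed
    then have "((\<lambda>t. \<Sum>b\<in>Basis. ((x - p) \<bullet> b) * ?D b (p + t *\<^sub>R (x - p))) has_integral
        (F (p + 1 *\<^sub>R (x - p)) - F (p + 0 *\<^sub>R (x - p)))) {0..1}"
      by (intro fundamental_theorem_of_calculus) auto
    then have "F x - F p = integral {0..1} (\<lambda>t. \<Sum>b\<in>Basis. ((x - p) \<bullet> b) * ?D b (p + t *\<^sub>R (x - p)))"
      by (simp add: integral_unique)
    also have "\<dots> = (\<Sum>b\<in>Basis. ((x - p) \<bullet> b) * a b x)"
    proof -
      have "(\<lambda>t. ?D b (p + t *\<^sub>R (x - p))) integrable_on {0..1}" for b
        unfolding cbox_interval[symmetric]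
        by (intro integrable_continuous continuous_intros
            continuous_on_compose2[OF Cinf_on_imp_continuous_on[OF D]])
          (use x in \<open>auto intro!: segment_in_convex assms\<close>)
      then show ?thesis
        unfolding a_def by (subst integral_sum) (auto intro: integrable_on_mult_right)
    qed
    finally show ?thesis by simp
  qed
  ultimately show ?thesis by blast
qed

section \<open>Derivations on manifolds and their products\<close>

lemma chart_inverse: "is_chart D c \<Longrightarrow> x \<in> D \<Longrightarrow> inv_into D c (c x) = x"
  unfolding is_chart_def homeomorphism_def by blast

lemma chart_inj_on: "is_chart D c \<Longrightarrow> inj_on c D"
  by (metis chart_inverse inj_onI)

lemma open_chart_image:
  assumes "is_chart D c" "open N" "N \<subseteq> D"
  shows "open (c ` N)"
proof -
  have "openin (top_of_set D) N" using assms by (auto simp: openin_open)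
  then have "openin (top_of_set (c ` D)) (c ` N)"
    using assms(1) homeomorphism_imp_open_map unfolding is_chart_def by blast
  then show ?thesis
    using assms(1) by (auto simp: is_chart_def openin_open_eq)
qed

lemma open_chart_inverse_image:
  assumes "is_chart D c" "open V" "V \<subseteq> c ` D"
  shows "open (inv_into D c ` V)"
proof -
  have "openin (top_of_set (c ` D)) V" using assms by (auto simp: openin_open)
  then have "openin (top_of_set D) (inv_into D c ` V)"
    using assms(1) homeomorphism_imp_open_map homeomorphism_sym unfolding is_chart_def by blast
  then show ?thesis
    using assms(1) by (auto simp: is_chart_def openin_open_eq)
qed

lemma smooth_functionsD:
  "h \<in> smooth_functions A \<Longrightarrow> (D, c) \<in> A \<Longrightarrow> Cinf_on (c ` D) (h \<circ> inv_into D c)"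
  unfolding smooth_functions_def by blast

lemma tangent_space_outside: "v \<in> tangent_space A p \<Longrightarrow> h \<notin> smooth_functions A \<Longrightarrow> v h = 0"
  unfolding tangent_space_def by blast

lemma tangent_space_mult:
  "\<lbrakk>v \<in> tangent_space A p; h \<in> smooth_functions A; k \<in> smooth_functions A\<rbrakk>
    \<Longrightarrow> v (\<lambda>x. h x * k x) = v h * k p + h p * v k"
  unfolding tangent_space_def by blast

lemma tangent_space_linear:
  "\<lbrakk>v \<in> tangent_space A p; h \<in> smooth_functions A; k \<in> smooth_functions A\<rbrakk>
    \<Longrightarrow> v (\<lambda>x. a * h x + b * k x) = a * v h + b * v k"
  unfolding tangent_space_def by blast

lemma tangent_space_eqI:
  assumes "v \<in> tangent_space A p" "w \<in> tangent_space A p"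
    and "\<And>h. h \<in> smooth_functions A \<Longrightarrow> v h = w h"
  shows "v = w"
  using assms by (metis ext tangent_space_outside)

lemma tangent_space_lincomb:
  assumes "v \<in> tangent_space A p" "w \<in> tangent_space A p"
  shows "a *\<^sub>R v + b *\<^sub>R w \<in> tangent_space A p"
  unfolding tangent_space_def
  using assms[THEN tangent_space_outside] assms[THEN tangent_space_linear] assms[THEN tangent_space_mult]
  by (auto simp: scaleR_fun_def algebra_simps)

lemma tangent_space_zero: "0 \<in> tangent_space A p"
  unfolding tangent_space_def by (auto simp: zero_fun_def)

lemma tangent_space_scaleR: "v \<in> tangent_space A p \<Longrightarrow> a *\<^sub>R v \<in> tangent_space A p"
  using tangent_space_lincomb[of v A p v a 0] by simp

lemma tangent_space_add:
  "\<lbrakk>v \<in> tangent_space A p; w \<in> tangent_space A p\<rbrakk> \<Longrightarrow> v + w \<in> tangent_space A p"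
  using tangent_space_lincomb[of v A p w 1 1] by simp

lemma tangent_space_diff:
  "\<lbrakk>v \<in> tangent_space A p; w \<in> tangent_space A p\<rbrakk> \<Longrightarrow> v - w \<in> tangent_space A p"
  using tangent_space_lincomb[of v A p w 1 "- 1"] by simp

lemma tangent_space_uminus: "v \<in> tangent_space A p \<Longrightarrow> - v \<in> tangent_space A p"
  using tangent_space_scaleR[of v A p "- 1"] by simp

lemma linear_over_tangent:
  assumes "linear_over (tangent_space A p) F" "v \<in> tangent_space A p" "w \<in> tangent_space A p"
  shows "F (v + w) = F v + F w" "F (v - w) = F v - F w" "F (a *\<^sub>R v) = a *\<^sub>R F v" "F (- v) = - F v" "F 0 = 0"
proof -
  have l: "F (a *\<^sub>R v + b *\<^sub>R w) = a *\<^sub>R F v + b *\<^sub>R F w" for a b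
    using assms unfolding linear_over_def by blast
  show "F (v + w) = F v + F w" "F (v - w) = F v - F w" "F (a *\<^sub>R v) = a *\<^sub>R F v" "F (- v) = - F v" "F 0 = 0"
    using l[of 1 1] l[of 1 "- 1"] l[of a 0] l[of "- 1" 0] l[of 0 0] by auto
qed

lemma vector_field_tangent: "X \<in> vector_fields A \<Longrightarrow> X p \<in> tangent_space A p"
  unfolding vector_fields_def by blast

lemma vector_field_smooth:
  "X \<in> vector_fields A \<Longrightarrow> h \<in> smooth_functions A \<Longrightarrow> (\<lambda>p. X p h) \<in> smooth_functions A"
  unfolding vector_fields_def by blast

section \<open>Localization of derivations and their coordinate expression\<close>

context smooth_manifold
begin

lemma open_chart: "(D, c) \<in> A \<Longrightarrow> open (c ` D)"
  using charts by (auto simp: is_chart_def)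

lemma exists_chart: obtains D c where "(D, c) \<in> A" "p \<in> D"
proof -
  have "p \<in> (\<Union>(D, c)\<in>A. D)" using covers by simp
  then show ?thesis using that by auto
qed

text \<open>\<open>smooth_functions\<close> demands smoothness in every chart on its whole domain.
  Composing with transition maps carries smoothness from one chart near a point to all others, so
  one conveniently chosen chart per point is enough.\<close>

lemma smooth_functions_localI:
  assumes "\<And>p. \<exists>D c N. (D, c) \<in> A \<and> open N \<and> p \<in> N \<and> N \<subseteq> D \<and> Cinf_on (c ` N) (h \<circ> inv_into D c)"
  shows "h \<in> smooth_functions A"
proof -
  have "Cinf_on (c' ` D') (h \<circ> inv_into D' c')" if A': "(D', c') \<in> A" for D' c'
  proof (rule Cinf_on_local)
    show "open (c' ` D')" using open_chart A' .
    fix y assume "y \<in> c' ` D'"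
    then obtain p where p: "p \<in> D'" "y = c' p" by blast
    obtain D c N where N: "(D, c) \<in> A" "open N" "p \<in> N" "N \<subseteq> D" "Cinf_on (c ` N) (h \<circ> inv_into D c)"
      using assms by blast
    note ch = charts[OF A'] charts[OF N(1)]
    let ?T = "c' ` (D' \<inter> N)"
    have "open D'" using ch by (simp add: is_chart_def)
    then have o: "open ?T" using ch(1) N by (intro open_chart_image[of D']) auto
    have "Cinf_on ?T (\<lambda>z. (h \<circ> inv_into D c) ((c \<circ> inv_into D' c') z))"
    proof (rule Cinf_on_compose[OF o, where T = "c ` N"])
      show "open (c ` N)" using open_chart_image ch N by blast
      show "(c \<circ> inv_into D' c') ` ?T \<subseteq> c ` N" using chart_inverse[OF ch(1)] by auto
      show "Cinf_on ?T (c \<circ> inv_into D' c')"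
        using Cinf_on_subset[OF compatible[OF A' N(1)] image_mono[OF Int_mono[OF order_refl N(4)]]] .
    qed fact
    then have "Cinf_on ?T (h \<circ> inv_into D' c')"
    proof (rule Cinf_on_cong[OF o, rotated])
      fix x assume "x \<in> ?T"
      then obtain q where "q \<in> D'" "q \<in> N" "x = c' q" by blast
      then show "(h \<circ> inv_into D c) ((c \<circ> inv_into D' c') x) = (h \<circ> inv_into D' c') x"
        using N(4) chart_inverse[OF ch(1), of q] chart_inverse[OF ch(2), of q] by auto
    qed
    then show "\<exists>T. open T \<and> y \<in> T \<and> Cinf_on T (h \<circ> inv_into D' c')"
      using o p N by blast
  qed
  then show ?thesis by (auto simp: smooth_functions_def)
qed

lemma smooth_const: "(\<lambda>_. a) \<in> smooth_functions A"
  by (auto simp: smooth_functions_def o_def intro!: Cinf_on_const open_chart)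

lemma smooth_add:
  "\<lbrakk>h \<in> smooth_functions A; k \<in> smooth_functions A\<rbrakk> \<Longrightarrow> (\<lambda>x. h x + k x) \<in> smooth_functions A"
  by (force simp: smooth_functions_def o_def intro!: Cinf_on_add open_chart)

lemma smooth_mult:
  "\<lbrakk>h \<in> smooth_functions A; k \<in> smooth_functions A\<rbrakk> \<Longrightarrow> (\<lambda>x. h x * k x) \<in> smooth_functions A"
  by (force simp: smooth_functions_def o_def intro!: Cinf_on_mult open_chart)

lemma smooth_diff:
  "\<lbrakk>h \<in> smooth_functions A; k \<in> smooth_functions A\<rbrakk> \<Longrightarrow> (\<lambda>x. h x - k x) \<in> smooth_functions A"
  using smooth_add[OF _ smooth_mult[OF smooth_const[of "- 1"]]] by fastforce

lemma smooth_sum: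
  "(\<And>i. i \<in> I \<Longrightarrow> h i \<in> smooth_functions A) \<Longrightarrow> (\<lambda>x. \<Sum>i\<in>I. h i x) \<in> smooth_functions A"
  by (induction I rule: infinite_finite_induct) (auto intro: smooth_const smooth_add)

lemma tangent_const:
  assumes "v \<in> tangent_space A p" shows "v (\<lambda>_. a) = 0"
proof -
  have "v (\<lambda>_. 1) = v (\<lambda>_. 1) + v (\<lambda>_. 1)"
    using tangent_space_mult[OF assms smooth_const[of 1] smooth_const[of 1]] by simp
  then show ?thesis
    using tangent_space_linear[OF assms smooth_const[of 1] smooth_const[of 1], of a 0] by simp
qed

lemma tangent_add:
  "\<lbrakk>v \<in> tangent_space A p; h \<in> smooth_functions A; k \<in> smooth_functions A\<rbrakk>
    \<Longrightarrow> v (\<lambda>x. h x + k x) = v h + v k"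
  using tangent_space_linear[of v A p h k 1 1] by simp

lemma tangent_diff:
  "\<lbrakk>v \<in> tangent_space A p; h \<in> smooth_functions A; k \<in> smooth_functions A\<rbrakk>
    \<Longrightarrow> v (\<lambda>x. h x - k x) = v h - v k"
  using tangent_space_linear[of v A p h k 1 "- 1"] by simp

lemma tangent_sum:
  assumes "v \<in> tangent_space A p" "\<And>i. i \<in> I \<Longrightarrow> h i \<in> smooth_functions A"
  shows "v (\<lambda>x. \<Sum>i\<in>I. h i x) = (\<Sum>i\<in>I. v (h i))"
  using assms(2)
proof (induction I rule: infinite_finite_induct)
  case (insert i I)
  then show ?case
    using tangent_add[OF assms(1), of "h i" "\<lambda>x. \<Sum>i\<in>I. h i x"] by (simp add: smooth_sum)
qed (use tangent_const[OF assms(1)] in auto)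

lemma vector_field_lincomb:
  assumes "X \<in> vector_fields A" "Y \<in> vector_fields A"
  shows "(\<lambda>p. a *\<^sub>R X p + b *\<^sub>R Y p) \<in> vector_fields A"
proof -
  have "(\<lambda>p. a * X p h + b * Y p h) \<in> smooth_functions A" if "h \<in> smooth_functions A" for h
    using assms[THEN vector_field_smooth, OF that]
    by (simp add: smooth_add smooth_mult smooth_const)
  then show ?thesis
    using tangent_space_lincomb[OF assms[THEN vector_field_tangent]]
    unfolding vector_fields_def by (auto simp: scaleR_fun_def)
qed

lemma vector_field_zero: "0 \<in> vector_fields A"
  using tangent_space_zero smooth_const[of 0] by (auto simp: vector_fields_def zero_fun_def)

text \<open>\<open>G\<close> is multiplied in the chart by a bump function supported in a closed
  ball inside \<open>V\<close> and extended by 0; on the half-size ball, which becomes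
  \<open>N\<close>, nothing is changed.\<close>

lemma smooth_extension:
  assumes D: "(D, c) \<in> A" "p \<in> D" and V: "open V" "c p \<in> V" "V \<subseteq> c ` D" "Cinf_on V G"
  shows "\<exists>k N. k \<in> smooth_functions A \<and> open N \<and> p \<in> N \<and> N \<subseteq> D \<and> c ` N \<subseteq> V \<and>
    (\<forall>x\<in>N. k x = G (c x)) \<and> (\<forall>x. \<not> (x \<in> D \<and> c x \<in> V) \<longrightarrow> k x = 0)"
proof -
  note ch = charts[OF D(1)]
  let ?i = "inv_into D c"
  obtain r where r: "r > 0" "cball (c p) r \<subseteq> V"
    using V by (meson open_contains_cball)
  obtain \<beta> where \<beta>: "Cinf_on UNIV \<beta>" "\<And>x. x \<in> ball (c p) (r / 2) \<Longrightarrow> \<beta> x = (1 :: real)"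
      "\<And>x. x \<notin> ball (c p) r \<Longrightarrow> \<beta> x = 0"
    using exists_bump[of "r / 2" r "c p"] r by auto
  define k where "k x = (if x \<in> D \<and> c x \<in> V then \<beta> (c x) * G (c x) else 0)" for x
  define N where "N = ?i ` ball (c p) (r / 2)"
  define K where "K = ?i ` cball (c p) r"
  have b: "ball (c p) (r / 2) \<subseteq> cball (c p) r" using r by auto
  have "compact K"
    unfolding K_def using ch r V
    by (intro compact_continuous_image) (auto simp: is_chart_def homeomorphism_def intro: continuous_on_subset)
  \<comment> \<open>Hausdorffness enters here: \<open>K\<close> is closed in the whole manifold, not
    only in \<open>D\<close>. So every point outside the preimage of \<open>V\<close>, including
    boundary points of \<open>D\<close>, has a neighbourhood disjoint from \<open>K\<close>, on
    which \<open>k\<close> vanishes.\<close>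
  then have "closed K" by (rule compact_imp_closed)
  have ci: "c (?i y) = y" "?i y \<in> D" if "y \<in> V" for y
    using that V(3) by (auto simp: f_inv_into_f inv_into_into)
  have "k \<in> smooth_functions A"
  proof (rule smooth_functions_localI)
    fix q
    show "\<exists>D c N. (D, c) \<in> A \<and> open N \<and> q \<in> N \<and> N \<subseteq> D \<and> Cinf_on (c ` N) (k \<circ> inv_into D c)"
    proof (cases "q \<in> D \<and> c q \<in> V")
      case True
      have "Cinf_on V (\<lambda>y. \<beta> y * G y)"
        using Cinf_on_mult[OF V(1)] \<beta>(1) V(4) Cinf_on_subset by blast
      then have "Cinf_on V (k \<circ> ?i)"
        by (rule Cinf_on_cong[OF V(1), rotated]) (use ci in \<open>auto simp: k_def\<close>)
      moreover have "c ` ?i ` V = V" using ci by force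
      moreover have "q \<in> ?i ` V" using True chart_inverse[OF ch] by force
      ultimately show ?thesis
        using D ci open_chart_inverse_image[OF ch V(1,3)]
        by (intro exI[of _ D] exI[of _ c] exI[of _ "?i ` V"]) auto
    next
      case False
      have "q \<notin> K" using False r ci by (auto simp: K_def)
      obtain D' c' where D': "(D', c') \<in> A" "q \<in> D'" using exists_chart .
      note ch' = charts[OF D'(1)]
      have o: "open (D' - K)" using \<open>closed K\<close> ch' by (auto simp: is_chart_def intro: open_Diff)
      have "Cinf_on (c' ` (D' - K)) (k \<circ> inv_into D' c')"
      proof (rule Cinf_on_cong)
        show o': "open (c' ` (D' - K))" using open_chart_image[OF ch' o] by blast
        show "Cinf_on (c' ` (D' - K)) (\<lambda>_. 0)" using o' by (rule Cinf_on_const)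
        fix y assume "y \<in> c' ` (D' - K)"
        then obtain x where x: "x \<in> D'" "x \<notin> K" "y = c' x" by blast
        have "k x = 0"
        proof (cases "x \<in> D \<and> c x \<in> V")
          case True
          then have "c x \<notin> cball (c p) r"
            using x(2) chart_inverse[OF ch, of x] by (metis K_def image_eqI)
          then show ?thesis using \<beta>(3)[of "c x"] by (auto simp: k_def)
        qed (auto simp: k_def)
        then show "0 = (k \<circ> inv_into D' c') y" using x chart_inverse[OF ch'] by simp
      qed
      then show ?thesis using D' o \<open>q \<notin> K\<close> by blast
    qed
  qed
  moreover have "open N"
    unfolding N_def using open_chart_inverse_image[OF ch] r V b by (meson open_ball order_trans)
  moreover have "p \<in> N"
    unfolding N_def using chart_inverse[OF ch D(2)] r by (metis centre_in_ball half_gt_zero image_eqI)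
  moreover have "N \<subseteq> D" "c ` N \<subseteq> V" using ci b r by (auto simp: N_def)
  moreover have "k x = G (c x)" if x: "x \<in> N" for x
  proof -
    obtain y where y: "y \<in> ball (c p) (r / 2)" "x = ?i y" using x unfolding N_def by blast
    then have "y \<in> V" using b r by auto
    then show ?thesis using ci[of y] y \<beta>(2) by (auto simp: k_def)
  qed
  moreover have "k x = 0" if "\<not> (x \<in> D \<and> c x \<in> V)" for x
    using that by (auto simp: k_def)
  ultimately show ?thesis by blast
qed

text \<open>Take a smooth \<beta> that is 1 near \<open>p\<close> and 0 outside \<open>N\<close>.
  Then \<beta>h = \<beta>k everywhere, and the product rule at \<open>p\<close>, with \<beta>(p) = 1
  and h(p) = k(p), leaves v h = v k.\<close>

lemma tangent_local:
  assumes v: "v \<in> tangent_space A p" and hk: "h \<in> smooth_functions A" "k \<in> smooth_functions A"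
    and N: "open N" "p \<in> N" "\<And>x. x \<in> N \<Longrightarrow> h x = k x"
  shows "v h = v k"
proof -
  obtain D c where D: "(D, c) \<in> A" "p \<in> D" using exists_chart .
  note ch = charts[OF D(1)]
  let ?V = "c ` (D \<inter> N)"
  have o: "open ?V" using ch N by (intro open_chart_image[of D]) (auto simp: is_chart_def)
  obtain \<beta> M where \<beta>: "\<beta> \<in> smooth_functions A" "p \<in> M" "\<forall>x\<in>M. \<beta> x = (1::real)"
      "\<And>x. \<not> (x \<in> D \<and> c x \<in> ?V) \<Longrightarrow> \<beta> x = 0"
    using smooth_extension[OF D o _ _ Cinf_on_const[OF o, of "1::real"]] D N by blast
  have "\<beta> x * h x = \<beta> x * k x" for x
  proof (cases "x \<in> N")
    case False
    then have "\<not> (x \<in> D \<and> c x \<in> ?V)"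
      using chart_inverse[OF ch] by (metis IntE imageE)
    then show ?thesis using \<beta>(4) by simp
  qed (use N in simp)
  then have "v (\<lambda>x. \<beta> x * h x) = v (\<lambda>x. \<beta> x * k x)" by presburger
  then show ?thesis
    using tangent_space_mult[OF v \<beta>(1)] hk \<beta> N(2,3) by simp
qed

text \<open>The coordinates of a chart are not global functions, so derivations cannot be applied to
  them directly; these are global smooth functions that agree with them near
  \<open>p\<close>.\<close>

lemma exists_coordinates:
  assumes "(D, c) \<in> A" "p \<in> D"
  shows "\<exists>x N. (\<forall>b. x b \<in> smooth_functions A) \<and> open N \<and> p \<in> N \<and> N \<subseteq> D \<and>
    (\<forall>b\<in>Basis. \<forall>q\<in>N. x b q = c q \<bullet> b)"
proof -
  have "\<exists>k N. k \<in> smooth_functions A \<and> open N \<and> p \<in> N \<and> N \<subseteq> D \<and> (\<forall>q\<in>N. k q = c q \<bullet> b)" for b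
    using smooth_extension[OF assms open_chart[OF assms(1)] _ _
        Cinf_on_bounded_linear[OF bounded_linear_inner_left[of b] open_chart[OF assms(1)]]] assms
    by blast
  then obtain x N where x: "\<And>b. x b \<in> smooth_functions A \<and> open (N b) \<and> p \<in> N b \<and> N b \<subseteq> D \<and>
      (\<forall>q\<in>N b. x b q = c q \<bullet> b)"
    by metis
  have "open (\<Inter>b\<in>Basis. N b)" "p \<in> (\<Inter>b\<in>Basis. N b)" "(\<Inter>b\<in>Basis. N b) \<subseteq> D"
  proof -
    \<comment> \<open>An empty intersection would be the whole manifold and not lie in
      \<open>D\<close>.\<close>
    obtain b :: 'e where "b \<in> Basis" using nonempty_Basis by blast
    then show "(\<Inter>b\<in>Basis. N b) \<subseteq> D" using x by fast
  qed (use x in \<open>auto intro!: open_INT\<close>)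
  then show ?thesis
    using x by (intro exI[of _ x] exI[of _ "\<Inter>b\<in>Basis. N b"]) auto
qed

text \<open>In the Hadamard expansion of \<open>k\<close> each summand is a product whose first
  factor vanishes at \<open>p\<close>, so the product rule leaves v(x_b) times the partial
  derivative at \<open>p\<close>. The functions \<open>x\<close> and the set \<open>N\<close> are
  parameters because the same ones are to serve at all points of \<open>N\<close>, which makes the
  coefficients of a vector field smooth functions.\<close>

lemma tangent_coordinates:
  assumes v: "v \<in> tangent_space A p" and D: "(D, c) \<in> A" "p \<in> D"
    and x: "\<And>b. b \<in> Basis \<Longrightarrow> x b \<in> smooth_functions A"
    and N: "open N" "p \<in> N" "\<And>b q. b \<in> Basis \<Longrightarrow> q \<in> N \<Longrightarrow> x b q = c q \<bullet> b"
    and k: "k \<in> smooth_functions A"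
  shows "v k = (\<Sum>b\<in>Basis. v (x b) * frechet_derivative (k \<circ> inv_into D c) (at (c p)) b)"
proof -
  note ch = charts[OF D(1)]
  let ?i = "inv_into D c"
  obtain r where r: "r > 0" "ball (c p) r \<subseteq> c ` D"
    using open_chart[OF D(1)] D(2) by (metis image_eqI open_contains_ball)
  let ?U = "ball (c p) r"
  have U: "open ?U" "convex ?U" "c p \<in> ?U" using r by auto
  obtain a where a: "\<And>b. Cinf_on ?U (a b)" "\<And>b. a b (c p) = frechet_derivative (k \<circ> ?i) (at (c p)) b"
    "\<And>y. y \<in> ?U \<Longrightarrow> (k \<circ> ?i) y = (k \<circ> ?i) (c p) + (\<Sum>b\<in>Basis. ((y - c p) \<bullet> b) * a b y)"
    using hadamard[OF U Cinf_on_subset[OF smooth_functionsD[OF k D(1)] r(2)]] by blast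
  have "\<exists>k N. k \<in> smooth_functions A \<and> open N \<and> p \<in> N \<and> N \<subseteq> D \<and> c ` N \<subseteq> ?U \<and> (\<forall>x\<in>N. k x = a b (c x))" for b
    using smooth_extension[OF D U(1,3) r(2) a(1)[of b]] by blast
  then obtain a' M where a': "\<And>b. a' b \<in> smooth_functions A \<and> open (M b) \<and> p \<in> M b \<and> M b \<subseteq> D \<and> c ` M b \<subseteq> ?U
      \<and> (\<forall>x\<in>M b. a' b x = a b (c x))"
    by metis
  \<comment> \<open>Hadamard's expansion with coordinates and coefficients replaced by global smooth
    functions; it equals \<open>k\<close> only near \<open>p\<close>, which suffices by
    \<open>tangent_local\<close>.\<close>
  define R where "R q = k p + (\<Sum>b\<in>Basis. (x b q - c p \<bullet> b) * a' b q)" for q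
  have xs: "(\<lambda>q. x b q - c p \<bullet> b) \<in> smooth_functions A" if "b \<in> Basis" for b
    using that by (intro smooth_diff smooth_const x)
  have s: "(\<lambda>q. (x b q - c p \<bullet> b) * a' b q) \<in> smooth_functions A" if "b \<in> Basis" for b
    using that a' by (intro smooth_mult xs) auto
  have R: "R \<in> smooth_functions A"
    unfolding R_def[abs_def] by (intro smooth_add smooth_const smooth_sum s)
  have "v k = v R"
  proof (rule tangent_local[OF v k R])
    let ?W = "N \<inter> (\<Inter>b\<in>Basis. M b)"
    show "open ?W" using N a' by (intro open_Int open_INT) auto
    show "p \<in> ?W" using N a' by auto
    fix q assume q: "q \<in> ?W"
    obtain b :: 'e where "b \<in> Basis" using nonempty_Basis by blast
    then have "q \<in> M b" using q by blast
    then have "q \<in> D" "c q \<in> ?U" using a'[of b] by blast+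
    then have "k q = k p + (\<Sum>b\<in>Basis. ((c q - c p) \<bullet> b) * a b (c q))"
      using a(3)[of "c q"] chart_inverse[OF ch] D by simp
    also have "\<dots> = R q"
      using N(3) a' q by (auto simp: R_def inner_diff_left)
    finally show "k q = R q" .
  qed
  also have "\<dots> = (\<Sum>b\<in>Basis. v (\<lambda>q. (x b q - c p \<bullet> b) * a' b q))"
    unfolding R_def[abs_def]
    using tangent_add[OF v smooth_const smooth_sum[OF s], of Basis "\<lambda>b. b"] tangent_const[OF v]
      tangent_sum[OF v s, of Basis "\<lambda>b. b"] by simp
  also have "\<dots> = (\<Sum>b\<in>Basis. v (x b) * frechet_derivative (k \<circ> inv_into D c) (at (c p)) b)"
  proof (rule sum.cong)
    fix b :: 'e assume b: "b \<in> Basis"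
    have "v (\<lambda>q. (x b q - c p \<bullet> b) * a' b q) = v (\<lambda>q. x b q - c p \<bullet> b) * a' b p + (x b p - c p \<bullet> b) * v (a' b)"
      using a' by (intro tangent_space_mult[OF v] xs b) auto
    also have "v (\<lambda>q. x b q - c p \<bullet> b) = v (x b)"
      using tangent_diff[OF v x[OF b] smooth_const] tangent_const[OF v] by simp
    finally show "v (\<lambda>q. (x b q - c p \<bullet> b) * a' b q) = v (x b) * frechet_derivative (k \<circ> inv_into D c) (at (c p)) b"
      using N(3)[OF b N(2)] a' a(2) by simp
  qed simp
  finally show ?thesis .
qed

end

section \<open>The product atlas and smooth functions on the product\<close>

lemma map_prod_inverse:
  assumes "is_chart D c" "is_chart D' c'" "z \<in> c ` D \<times> c' ` D'"
  shows "inv_into (D \<times> D') (map_prod c c') z = (inv_into D c (fst z), inv_into D' c' (snd z))"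
proof -
  obtain x y where xy: "x \<in> D" "y \<in> D'" "z = (c x, c' y)" using assms(3) by auto
  have "inj_on (map_prod c c') (D \<times> D')"
    using assms(1,2)[THEN chart_inj_on] by (rule map_prod_inj_on)
  then have "inv_into (D \<times> D') (map_prod c c') (map_prod c c' (x, y)) = (x, y)"
    using xy by (intro inv_into_f_f) auto
  then show ?thesis
    using xy chart_inverse[OF assms(1) xy(1)] chart_inverse[OF assms(2) xy(2)] by simp
qed

lemma is_chart_prod:
  assumes "is_chart D c" "is_chart D' c'"
  shows "is_chart (D \<times> D') (map_prod c c')"
proof -
  let ?I = "inv_into (D \<times> D') (map_prod c c')"
  have im: "map_prod c c' ` (D \<times> D') = c ` D \<times> c' ` D'" by force
  note I = map_prod_inverse[OF assms]
  have "continuous_on (D \<times> D') (map_prod c c')"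
    using assms unfolding map_prod_def case_prod_beta is_chart_def homeomorphism_def
    by (intro continuous_on_Pair continuous_on_compose2[OF _ continuous_on_fst[OF continuous_on_id]]
        continuous_on_compose2[OF _ continuous_on_snd[OF continuous_on_id]]) auto
  moreover have "continuous_on (c ` D \<times> c' ` D') (\<lambda>z. (inv_into D c (fst z), inv_into D' c' (snd z)))"
    using assms unfolding is_chart_def homeomorphism_def
    by (intro continuous_on_Pair continuous_on_compose2[OF _ continuous_on_fst[OF continuous_on_id]]
        continuous_on_compose2[OF _ continuous_on_snd[OF continuous_on_id]]) auto
  then have "continuous_on (c ` D \<times> c' ` D') ?I"
    using I by (simp cong: continuous_on_cong)
  moreover have "?I ` (c ` D \<times> c' ` D') \<subseteq> D \<times> D'"
    by (metis im image_subsetI inv_into_into)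
  moreover have "?I (map_prod c c' x) = x" if "x \<in> D \<times> D'" for x
    using that I[of "map_prod c c' x"] chart_inverse[OF assms(1)] chart_inverse[OF assms(2)] by auto
  moreover have "map_prod c c' (?I z) = z" if "z \<in> c ` D \<times> c' ` D'" for z
    using that im by (metis f_inv_into_f)
  ultimately have "homeomorphism (D \<times> D') (c ` D \<times> c' ` D') (map_prod c c') ?I"
    by (intro homeomorphismI) (auto simp: im)
  then show ?thesis
    using assms im by (auto simp: is_chart_def open_Times)
qed

lemma smooth_manifold_prod:
  assumes "smooth_manifold A" "smooth_manifold B"
  shows "smooth_manifold (prod_atlas A B)"
proof -
  interpret A: smooth_manifold A by fact
  interpret B: smooth_manifold B by fact
  show ?thesis
  proof
    fix D c assume "(D, c) \<in> prod_atlas A B"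
    then show "is_chart D c"
      by (auto simp: prod_atlas_def intro: is_chart_prod A.charts B.charts)
  next
    have "z \<in> (\<Union>(D, c)\<in>prod_atlas A B. D)" for z
    proof -
      obtain D c where "(D, c) \<in> A" "fst z \<in> D" using A.exists_chart .
      moreover obtain D' c' where "(D', c') \<in> B" "snd z \<in> D'" using B.exists_chart .
      ultimately have "(D \<times> D', map_prod c c') \<in> prod_atlas A B" "z \<in> D \<times> D'"
        by (auto simp: prod_atlas_def mem_Times_iff)
      then show ?thesis by blast
    qed
    then show "(\<Union>(D, c)\<in>prod_atlas A B. D) = UNIV" by blast
  next
    fix D1 c1 D2 c2 assume "(D1, c1) \<in> prod_atlas A B" "(D2, c2) \<in> prod_atlas A B"
    then obtain D c D' c' E e E' e' where a: "(D, c) \<in> A" "(D', c') \<in> B" "(E, e) \<in> A" "(E', e') \<in> B"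
      and eq: "D1 = D \<times> D'" "c1 = map_prod c c'" "D2 = E \<times> E'" "c2 = map_prod e e'"
      by (auto simp: prod_atlas_def)
    note ch = A.charts[OF a(1)] B.charts[OF a(2)]
    let ?S = "c ` (D \<inter> E)" and ?T = "c' ` (D' \<inter> E')"
    have S: "open ?S" "open ?T"
      using ch A.charts[OF a(3)] B.charts[OF a(4)]
      by (auto simp: is_chart_def intro!: open_chart_image[OF ch(1)] open_chart_image[OF ch(2)])
    have im: "c1 ` (D1 \<inter> D2) = ?S \<times> ?T" by (force simp: eq)
    have o: "open (?S \<times> ?T)" using S by (rule open_Times)
    have "Cinf_on (?S \<times> ?T) (\<lambda>z. ((e \<circ> inv_into D c) (fst z), (e' \<circ> inv_into D' c') (snd z)))"
      by (intro Cinf_on_Pair o Cinf_on_compose[OF o S(1) _ A.compatible[OF a(1,3)]]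
          Cinf_on_compose[OF o S(2) _ B.compatible[OF a(2,4)]]
          Cinf_on_bounded_linear[OF bounded_linear_fst] Cinf_on_bounded_linear[OF bounded_linear_snd]) auto
    then show "Cinf_on (c1 ` (D1 \<inter> D2)) (c2 \<circ> inv_into D1 c1)"
      unfolding im
    proof (rule Cinf_on_cong[OF o, rotated])
      fix z assume "z \<in> ?S \<times> ?T"
      then have "z \<in> c ` D \<times> c' ` D'" by auto
      then show "((e \<circ> inv_into D c) (fst z), (e' \<circ> inv_into D' c') (snd z)) = (c2 \<circ> inv_into D1 c1) z"
        using map_prod_inverse[OF ch] by (simp add: eq)
    qed
  qed
qed

text \<open>Together with \<open>smooth_prodD\<close>, this trades the inverse of a product chart
  for the pair of inverses, so that later arguments work with the two variables separately.\<close>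

lemma smooth_prodI:
  assumes "smooth_manifold A" "smooth_manifold B"
    and "\<And>D c D' c'. (D, c) \<in> A \<Longrightarrow> (D', c') \<in> B \<Longrightarrow>
      Cinf_on (c ` D \<times> c' ` D') (\<lambda>z. h (inv_into D c (fst z), inv_into D' c' (snd z)))"
  shows "h \<in> smooth_functions (prod_atlas A B)"
proof -
  interpret A: smooth_manifold A by fact
  interpret B: smooth_manifold B by fact
  have "Cinf_on (map_prod c c' ` (D \<times> D')) (h \<circ> inv_into (D \<times> D') (map_prod c c'))"
    if a: "(D, c) \<in> A" "(D', c') \<in> B" for D c D' c'
  proof -
    have "map_prod c c' ` (D \<times> D') = c ` D \<times> c' ` D'" by force
    moreover have "open (c ` D \<times> c' ` D')"
      using A.open_chart[OF a(1)] B.open_chart[OF a(2)] by (rule open_Times)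
    ultimately show ?thesis
      using map_prod_inverse[OF A.charts[OF a(1)] B.charts[OF a(2)]]
      by (auto intro!: Cinf_on_cong[OF _ _ assms(3)[OF a]])
  qed
  then show ?thesis by (auto simp: smooth_functions_def prod_atlas_def)
qed

lemma smooth_prodD:
  assumes "smooth_manifold A" "smooth_manifold B" "h \<in> smooth_functions (prod_atlas A B)"
    and "(D, c) \<in> A" "(D', c') \<in> B"
  shows "Cinf_on (c ` D \<times> c' ` D') (\<lambda>z. h (inv_into D c (fst z), inv_into D' c' (snd z)))"
proof -
  interpret A: smooth_manifold A by fact
  interpret B: smooth_manifold B by fact
  have "(D \<times> D', map_prod c c') \<in> prod_atlas A B" using assms by (auto simp: prod_atlas_def)
  from smooth_functionsD[OF assms(3) this]
  have "Cinf_on (c ` D \<times> c' ` D') (h \<circ> inv_into (D \<times> D') (map_prod c c'))"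
    by (metis map_prod_surj_on)
  moreover have "open (c ` D \<times> c' ` D')"
    using A.open_chart[OF assms(4)] B.open_chart[OF assms(5)] by (rule open_Times)
  ultimately show ?thesis
    using map_prod_inverse[OF A.charts[OF assms(4)] B.charts[OF assms(5)]]
    by (auto intro: Cinf_on_cong[rotated 2])
qed

text \<open>The symmetry by which facts about the second factor are obtained from those about the
  first.\<close>

lemma smooth_swap:
  assumes "smooth_manifold A" "smooth_manifold B" "h \<in> smooth_functions (prod_atlas A B)"
  shows "(\<lambda>z. h (snd z, fst z)) \<in> smooth_functions (prod_atlas B A)"
proof (rule smooth_prodI[OF assms(2,1)])
  interpret A: smooth_manifold A by fact
  interpret B: smooth_manifold B by fact
  fix D c D' c' assume a: "(D, c) \<in> B" "(D', c') \<in> A"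
  have bl: "bounded_linear (\<lambda>z::'d \<times> 'b. (snd z, fst z))"
    by (intro bounded_linear_Pair bounded_linear_snd bounded_linear_fst)
  have o: "open (c ` D \<times> c' ` D')" "open (c' ` D' \<times> c ` D)"
    using B.open_chart[OF a(1)] A.open_chart[OF a(2)] by (auto intro: open_Times)
  have "Cinf_on (c ` D \<times> c' ` D')
      (\<lambda>z. (\<lambda>u. h (inv_into D' c' (fst u), inv_into D c (snd u))) (snd z, fst z))"
    by (rule Cinf_on_compose[OF o _ smooth_prodD[OF assms a(2,1)] Cinf_on_bounded_linear[OF bl o(1)]]) auto
  then show "Cinf_on (c ` D \<times> c' ` D')
      (\<lambda>z. h (snd (inv_into D c (fst z), inv_into D' c' (snd z)), fst (inv_into D c (fst z), inv_into D' c' (snd z))))"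
    by simp
qed

lemma smooth_slice_fst:
  assumes "smooth_manifold A" "smooth_manifold B" "h \<in> smooth_functions (prod_atlas A B)"
  shows "(\<lambda>x. h (x, q)) \<in> smooth_functions A"
proof -
  interpret A: smooth_manifold A by fact
  interpret B: smooth_manifold B by fact
  obtain D' c' where D': "(D', c') \<in> B" "q \<in> D'" using B.exists_chart .
  have "Cinf_on (c ` D) ((\<lambda>x. h (x, q)) \<circ> inv_into D c)" if a: "(D, c) \<in> A" for D c
  proof -
    have o: "open (c ` D)" "open (c ` D \<times> c' ` D')"
      using A.open_chart[OF a] B.open_chart[OF D'(1)] by (auto intro: open_Times)
    have "Cinf_on (c ` D) (\<lambda>y. (y, c' q))"
      by (intro Cinf_on_Pair Cinf_on_const Cinf_on_bounded_linear[OF bounded_linear_ident] o)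
    from Cinf_on_compose[OF o _ smooth_prodD[OF assms a D'(1)] this]
    show ?thesis
      using D'(2) chart_inverse[OF B.charts[OF D'(1)] D'(2)] by (simp add: o_def image_subset_iff)
  qed
  then show ?thesis by (auto simp: smooth_functions_def)
qed

lemma smooth_slice_snd:
  assumes "smooth_manifold A" "smooth_manifold B" "h \<in> smooth_functions (prod_atlas A B)"
  shows "(\<lambda>y. h (p, y)) \<in> smooth_functions B"
  using smooth_slice_fst[OF assms(2,1) smooth_swap[OF assms], of p] by simp

lemma smooth_comp_fst:
  assumes "smooth_manifold A" "smooth_manifold B" "h \<in> smooth_functions A"
  shows "(\<lambda>z. h (fst z)) \<in> smooth_functions (prod_atlas A B)"
proof (rule smooth_prodI[OF assms(1,2)])
  interpret A: smooth_manifold A by fact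
  interpret B: smooth_manifold B by fact
  fix D c D' c' assume a: "(D, c) \<in> A" "(D', c') \<in> B"
  have o: "open (c ` D \<times> c' ` D')"
    using A.open_chart[OF a(1)] B.open_chart[OF a(2)] by (auto intro: open_Times)
  show "Cinf_on (c ` D \<times> c' ` D') (\<lambda>z. h (fst (inv_into D c (fst z), inv_into D' c' (snd z))))"
    using Cinf_on_compose[OF o A.open_chart[OF a(1)] _ smooth_functionsD[OF assms(3) a(1)]
        Cinf_on_bounded_linear[OF bounded_linear_fst o]]
    by (simp add: image_subset_iff)
qed

lemma smooth_comp_snd:
  assumes "smooth_manifold A" "smooth_manifold B" "h \<in> smooth_functions B"
  shows "(\<lambda>z. h (snd z)) \<in> smooth_functions (prod_atlas A B)"
  using smooth_swap[OF assms(2,1) smooth_comp_fst[OF assms(2,1,3)]] by simp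

text \<open>Joint smoothness in both variables is the issue, since a vector field on the first
  factor only controls functions of the first variable. Near a point, X acts on the slice as the sum
  of X(x_b) \<partial>_b: the coefficients depend on the first variable alone, and the \<partial>_b
  are partial derivatives of the chart expression of \<open>h\<close> on the product, which are
  jointly smooth.\<close>

lemma smooth_partial_fst:
  fixes A :: "('a::{t2_space, second_countable_topology}, 'e::euclidean_space) atlas"
    and B :: "('b::{t2_space, second_countable_topology}, 'f::euclidean_space) atlas"
  assumes "smooth_manifold A" "smooth_manifold B" "h \<in> smooth_functions (prod_atlas A B)"
    and X: "X \<in> vector_fields A"
  shows "(\<lambda>z. X (fst z) (\<lambda>x. h (x, snd z))) \<in> smooth_functions (prod_atlas A B)"
proof (rule smooth_prodI[OF assms(1,2)])
  interpret A: smooth_manifold A by fact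
  interpret B: smooth_manifold B by fact
  fix D c D' c' assume a: "(D, c) \<in> A" "(D', c') \<in> B"
  note ch = A.charts[OF a(1)] B.charts[OF a(2)]
  let ?i = "inv_into D c" and ?j = "inv_into D' c'"
  let ?S = "c ` D \<times> c' ` D'"
  let ?H = "\<lambda>z. h (?i (fst z), ?j (snd z))"
  have o: "open ?S" using A.open_chart[OF a(1)] B.open_chart[OF a(2)] by (auto intro: open_Times)
  have H: "Cinf_on ?S ?H" using smooth_prodD[OF assms(1-3) a] .
  show "Cinf_on ?S (\<lambda>z. X (fst (?i (fst z), ?j (snd z))) (\<lambda>x. h (x, snd (?i (fst z), ?j (snd z)))))"
  proof (rule Cinf_on_local[OF o])
    fix z0 assume z0: "z0 \<in> ?S"
    then obtain p0 where p0: "p0 \<in> D" "fst z0 = c p0" by auto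
    obtain x N where x: "\<And>b. x b \<in> smooth_functions A" and N: "open N" "p0 \<in> N" "N \<subseteq> D"
      and xN: "\<And>b q. b \<in> Basis \<Longrightarrow> q \<in> N \<Longrightarrow> x b q = c q \<bullet> b"
      using A.exists_coordinates[OF a(1) p0(1)] by blast
    let ?T = "c ` N \<times> c' ` D'"
    have oT: "open ?T"
      using open_chart_image[OF ch(1) N(1,3)] B.open_chart[OF a(2)] by (rule open_Times)
    have TS: "?T \<subseteq> ?S" using N by blast
    have "Cinf_on ?T (\<lambda>z. \<Sum>b\<in>Basis. ((\<lambda>p. X p (x b)) \<circ> ?i) (fst z) * frechet_derivative ?H (at z) (b, 0))"
    proof (intro Cinf_on_sum[OF oT] Cinf_on_mult[OF oT])
      fix b
      show "Cinf_on ?T (\<lambda>z. ((\<lambda>p. X p (x b)) \<circ> ?i) (fst z))"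
        by (rule Cinf_on_compose[OF oT A.open_chart[OF a(1)] _
              smooth_functionsD[OF vector_field_smooth[OF X x] a(1)]
              Cinf_on_bounded_linear[OF bounded_linear_fst oT]]) (use TS in auto)
      show "Cinf_on ?T (\<lambda>z. frechet_derivative ?H (at z) (b, 0))"
        using Cinf_on_subset[OF Cinf_on_frechet_derivative[OF H] TS] .
    qed
    then have "Cinf_on ?T (\<lambda>z. X (fst (?i (fst z), ?j (snd z))) (\<lambda>x. h (x, snd (?i (fst z), ?j (snd z)))))"
    proof (rule Cinf_on_cong[OF oT, rotated])
      fix z assume z: "z \<in> ?T"
      then obtain p where p: "p \<in> N" "fst z = c p" by auto
      then have ip: "?i (fst z) = p" using chart_inverse[OF ch(1)] N by auto
      let ?k = "\<lambda>x. h (x, ?j (snd z))"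
      \<comment> \<open>Freezing the second variable turns the derivative of the slice into the
        joint derivative in a direction (v, 0).\<close>
      have "((\<lambda>y. ?H (y, snd z)) has_derivative (\<lambda>v. frechet_derivative ?H (at z) (v, 0))) (at (c p))"
      proof -
        have "((\<lambda>y. (y, snd z)) has_derivative (\<lambda>v. (v, 0))) (at (c p))"
          by (auto intro!: derivative_eq_intros)
        moreover have "(?H has_derivative frechet_derivative ?H (at z)) (at (c p, snd z))"
          unfolding p(2)[symmetric] prod.collapse
          by (rule Cinf_on_has_derivative[OF o H subsetD[OF TS z]])
        ultimately show ?thesis by (rule has_derivative_compose)
      qed
      then have "frechet_derivative (?k \<circ> ?i) (at (c p)) = (\<lambda>v. frechet_derivative ?H (at z) (v, 0))"
        unfolding o_def fst_conv snd_conv by (rule frechet_derivative_at[symmetric])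
      then have "X p ?k = (\<Sum>b\<in>Basis. X p (x b) * frechet_derivative ?H (at z) (b, 0))"
        using A.tangent_coordinates[OF vector_field_tangent[OF X] a(1) _ x N(1) p(1) xN
            smooth_slice_fst[OF assms(1-3), of "?j (snd z)"]] p N by auto
      then show "(\<Sum>b\<in>Basis. ((\<lambda>p. X p (x b)) \<circ> ?i) (fst z) * frechet_derivative ?H (at z) (b, 0))
          = X (fst (?i (fst z), ?j (snd z))) (\<lambda>x. h (x, snd (?i (fst z), ?j (snd z))))"
        using ip by simp
    qed
    moreover have "z0 \<in> ?T" using z0 p0 N by (auto simp: mem_Times_iff)
    ultimately show "\<exists>T. open T \<and> z0 \<in> T \<and>
        Cinf_on T (\<lambda>z. X (fst (?i (fst z), ?j (snd z))) (\<lambda>x. h (x, snd (?i (fst z), ?j (snd z)))))"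
      using oT by blast
  qed
qed

lemma smooth_partial_snd:
  assumes "smooth_manifold A" "smooth_manifold B" "h \<in> smooth_functions (prod_atlas A B)"
    and "U \<in> vector_fields B"
  shows "(\<lambda>z. U (snd z) (\<lambda>y. h (fst z, y))) \<in> smooth_functions (prod_atlas A B)"
  using smooth_swap[OF assms(2,1) smooth_partial_fst[OF assms(2,1) smooth_swap[OF assms(1-3)] assms(4)]]
  by simp

section \<open>Splitting of the tangent spaces of the product\<close>

locale product_manifold = A: smooth_manifold A + B: smooth_manifold B
  for A :: "('a::{t2_space, second_countable_topology}, 'e::euclidean_space) atlas"
    and B :: "('b::{t2_space, second_countable_topology}, 'f::euclidean_space) atlas"
begin

abbreviation "AB \<equiv> prod_atlas A B"

lemmas AB_manifolds = A.smooth_manifold_axioms B.smooth_manifold_axioms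

sublocale AB: smooth_manifold AB
  using smooth_manifold_prod[OF AB_manifolds] .

lemmas slice_fst = smooth_slice_fst[OF AB_manifolds]
lemmas slice_snd = smooth_slice_snd[OF AB_manifolds]
lemmas comp_fst = smooth_comp_fst[OF AB_manifolds]
lemmas comp_snd = smooth_comp_snd[OF AB_manifolds]

lemma pair_tvec_apply:
  "h \<in> smooth_functions AB \<Longrightarrow> pair_tvec A B (p, q) v w h = v (\<lambda>x. h (x, q)) + w (\<lambda>y. h (p, y))"
  by (simp add: pair_tvec_def)

lemma pair_tvec_tangent:
  assumes v: "v \<in> tangent_space A p" and w: "w \<in> tangent_space B q"
  shows "pair_tvec A B (p, q) v w \<in> tangent_space AB (p, q)"
  unfolding tangent_space_def
proof (intro CollectI conjI ballI allI impI)
  fix h k a b assume hk: "h \<in> smooth_functions AB" "k \<in> smooth_functions AB"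
  have s: "(\<lambda>x. a * h x + b * k x) \<in> smooth_functions AB" "(\<lambda>x. h x * k x) \<in> smooth_functions AB"
    by (intro AB.smooth_add AB.smooth_mult AB.smooth_const hk)+
  show "pair_tvec A B (p, q) v w (\<lambda>x. a * h x + b * k x)
      = a * pair_tvec A B (p, q) v w h + b * pair_tvec A B (p, q) v w k"
    using hk s tangent_space_linear[OF v hk[THEN slice_fst]] tangent_space_linear[OF w hk[THEN slice_snd]]
    by (simp add: pair_tvec_apply algebra_simps)
  show "pair_tvec A B (p, q) v w (\<lambda>x. h x * k x)
      = pair_tvec A B (p, q) v w h * k (p, q) + h (p, q) * pair_tvec A B (p, q) v w k"
    using hk s tangent_space_mult[OF v hk[THEN slice_fst]] tangent_space_mult[OF w hk[THEN slice_snd]]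
    by (simp add: pair_tvec_apply algebra_simps)
qed (simp add: pair_tvec_def)

lemma pair_field_vector_field:
  assumes X: "X \<in> vector_fields A" and U: "U \<in> vector_fields B"
  shows "pair_field A B X U \<in> vector_fields AB"
proof -
  have "(\<lambda>z. pair_field A B X U z h) \<in> smooth_functions AB" if h: "h \<in> smooth_functions AB" for h
  proof -
    have "(\<lambda>z. X (fst z) (\<lambda>x. h (x, snd z)) + U (snd z) (\<lambda>y. h (fst z, y))) \<in> smooth_functions AB"
      using smooth_partial_fst[OF AB_manifolds h X] smooth_partial_snd[OF AB_manifolds h U]
      by (rule AB.smooth_add)
    then show ?thesis
      using h by (simp add: pair_field_def pair_tvec_def case_prod_beta)
  qed
  moreover have "pair_field A B X U z \<in> tangent_space AB z" for z
    using pair_tvec_tangent[OF vector_field_tangent[OF X] vector_field_tangent[OF U]]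
    by (cases z) (simp add: pair_field_def)
  ultimately show ?thesis by (simp add: vector_fields_def)
qed

lemma pair_tvec_product:
  assumes v: "v \<in> tangent_space A p" and w: "w \<in> tangent_space B q"
    and a: "a \<in> smooth_functions A" and b: "b \<in> smooth_functions B"
  shows "pair_tvec A B (p, q) v w (\<lambda>z. a (fst z) * b (snd z)) = v a * b q + a p * w b"
proof -
  have "(\<lambda>z. a (fst z) * b (snd z)) \<in> smooth_functions AB"
    using a b by (intro AB.smooth_mult comp_fst comp_snd)
  then show ?thesis
    using tangent_space_mult[OF v a A.smooth_const[of "b q"]] A.tangent_const[OF v]
      tangent_space_mult[OF w B.smooth_const[of "a p"] b] B.tangent_const[OF w]
    by (simp add: pair_tvec_apply)
qed

lemma fst_pair_tvec:
  assumes v: "v \<in> tangent_space A p" and w: "w \<in> tangent_space B q"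
  shows "fst_tvec A (pair_tvec A B (p, q) v w) = v"
proof
  fix h show "fst_tvec A (pair_tvec A B (p, q) v w) h = v h"
    using comp_fst[of h] tangent_space_outside[OF v, of h] B.tangent_const[OF w]
    by (simp add: fst_tvec_def pair_tvec_apply o_def)
qed

lemma snd_pair_tvec:
  assumes v: "v \<in> tangent_space A p" and w: "w \<in> tangent_space B q"
  shows "snd_tvec B (pair_tvec A B (p, q) v w) = w"
proof
  fix h show "snd_tvec B (pair_tvec A B (p, q) v w) h = w h"
    using comp_snd[of h] tangent_space_outside[OF w, of h] A.tangent_const[OF v]
    by (simp add: snd_tvec_def pair_tvec_apply o_def)
qed

lemma fst_tvec_tangent:
  assumes u: "u \<in> tangent_space AB z"
  shows "fst_tvec A u \<in> tangent_space A (fst z)"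
  unfolding tangent_space_def
  using tangent_space_linear[OF u comp_fst comp_fst] tangent_space_mult[OF u comp_fst comp_fst]
    A.smooth_add A.smooth_mult A.smooth_const
  by (auto simp: fst_tvec_def o_def)

lemma snd_tvec_tangent:
  assumes u: "u \<in> tangent_space AB z"
  shows "snd_tvec B u \<in> tangent_space B (snd z)"
  unfolding tangent_space_def
  using tangent_space_linear[OF u comp_snd comp_snd] tangent_space_mult[OF u comp_snd comp_snd]
    B.smooth_add B.smooth_mult B.smooth_const
  by (auto simp: snd_tvec_def o_def)

lemma fst_tvec_diff: "fst_tvec A (u - v) = fst_tvec A u - fst_tvec A v"
  by (auto simp: fst_tvec_def fun_eq_iff)

lemma snd_tvec_diff: "snd_tvec B (u - v) = snd_tvec B u - snd_tvec B v"
  by (auto simp: snd_tvec_def fun_eq_iff)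

text \<open>Near (p, q) the product chart has as coordinates the pullbacks of coordinates of the two
  factors. By assumption \<open>u\<close> kills all such pullbacks, and
  \<open>tangent_coordinates\<close> expresses \<open>u h\<close> through them.\<close>

lemma tangent_prod_eq_0:
  assumes u: "u \<in> tangent_space AB (p, q)" and 0: "fst_tvec A u = 0" "snd_tvec B u = 0"
  shows "u = 0"
proof (rule tangent_space_eqI[OF u tangent_space_zero])
  fix h assume h: "h \<in> smooth_functions AB"
  obtain D c where D: "(D, c) \<in> A" "p \<in> D" using A.exists_chart .
  obtain D' c' where D': "(D', c') \<in> B" "q \<in> D'" using B.exists_chart .
  obtain x N where x: "\<And>b. x b \<in> smooth_functions A" "open N" "p \<in> N"
      "\<And>b q. b \<in> Basis \<Longrightarrow> q \<in> N \<Longrightarrow> x b q = c q \<bullet> b"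
    using A.exists_coordinates[OF D] by blast
  obtain y M where y: "\<And>b. y b \<in> smooth_functions B" "open M" "q \<in> M"
      "\<And>b q. b \<in> Basis \<Longrightarrow> q \<in> M \<Longrightarrow> y b q = c' q \<bullet> b"
    using B.exists_coordinates[OF D'] by blast
  \<comment> \<open>A basis vector of the product is (i, 0) or (0, j), and the test
    \<open>snd b = 0\<close> tells the two kinds apart.\<close>
  define X where "X b = (\<lambda>z. if snd b = 0 then x (fst b) (fst z) else y (snd b) (snd z))" for b
  have Xb: "X b \<in> smooth_functions AB \<and> u (X b) = 0 \<and> (\<forall>z\<in>N \<times> M. X b z = map_prod c c' z \<bullet> b)"
    if "b \<in> Basis" for b
  proof (cases "snd b = 0")
    case True
    then have "fst b \<in> Basis" "X b = (\<lambda>z. x (fst b) (fst z))"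
      using that by (auto simp: Basis_prod_def X_def)
    moreover have "u (\<lambda>z. x (fst b) (fst z)) = 0"
      using fun_cong[OF 0(1), of "x (fst b)"] x(1) by (simp add: fst_tvec_def o_def)
    ultimately show ?thesis
      using x comp_fst[OF x(1)] True by (auto simp: inner_prod_def)
  next
    case False
    then have "snd b \<in> Basis" "X b = (\<lambda>z. y (snd b) (snd z))" "fst b = 0"
      using that by (auto simp: Basis_prod_def X_def)
    moreover have "u (\<lambda>z. y (snd b) (snd z)) = 0"
      using fun_cong[OF 0(2), of "y (snd b)"] y(1) by (simp add: snd_tvec_def o_def)
    ultimately show ?thesis
      using y comp_snd[OF y(1)] by (auto simp: inner_prod_def)
  qed
  have "u h = (\<Sum>b\<in>Basis. u (X b) * frechet_derivative (h \<circ> inv_into (D \<times> D') (map_prod c c')) (at (map_prod c c' (p, q))) b)"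
  proof (rule AB.tangent_coordinates[OF u _ _ _ _ _ _ h])
    show "(D \<times> D', map_prod c c') \<in> AB" using D D' by (auto simp: prod_atlas_def)
    show "open (N \<times> M)" using x y by (auto intro: open_Times)
  qed (use D D' x y Xb in auto)
  then show "u h = 0 h" using Xb by simp
qed

end

section \<open>The connection of the warped contact metric\<close>

text \<open>Add metric compatibility for (X, Y, Z) and (Y, X, Z) and subtract it for (Z, X, Y);
  vanishing torsion turns the differences of connection terms into brackets. Of \<open>g\<close>
  itself this uses \<open>sym\<close> and \<open>diff\<close>.\<close>

lemma koszul_formula:
  assumes lc: "levi_civita_connection A g nabla"
    and sym: "\<And>p v w. \<lbrakk>v \<in> tangent_space A p; w \<in> tangent_space A p\<rbrakk> \<Longrightarrow> g p v w = g p w v"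
    and diff: "\<And>p u v w. \<lbrakk>u \<in> tangent_space A p; v \<in> tangent_space A p; w \<in> tangent_space A p\<rbrakk>
      \<Longrightarrow> g p (u - v) w = g p u w - g p v w"
    and XYZ: "X \<in> vector_fields A" "Y \<in> vector_fields A" "Z \<in> vector_fields A"
  shows "2 * g p (nabla X Y p) (Z p) =
    X p (\<lambda>q. g q (Y q) (Z q)) + Y p (\<lambda>q. g q (X q) (Z q)) - Z p (\<lambda>q. g q (X q) (Y q))
    + g p (lie_bracket X Y p) (Z p) - g p (lie_bracket X Z p) (Y p) - g p (lie_bracket Y Z p) (X p)"
proof -
  have comp: "U p (\<lambda>q. g q (V q) (W q)) = g p (nabla U V p) (W p) + g p (V p) (nabla U W p)"
    if "U \<in> vector_fields A" "V \<in> vector_fields A" "W \<in> vector_fields A" for U V W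
    using lc that unfolding levi_civita_connection_def by blast
  have nabla: "nabla U V p \<in> tangent_space A p"
    if "U \<in> vector_fields A" "V \<in> vector_fields A" for U V
    using lc that unfolding levi_civita_connection_def affine_connection_def
    by (blast intro: vector_field_tangent)
  have tors: "g p (lie_bracket U V p) (W p) = g p (nabla U V p) (W p) - g p (nabla V U p) (W p)"
    if "U \<in> vector_fields A" "V \<in> vector_fields A" "W \<in> vector_fields A" for U V W
  proof -
    have "lie_bracket U V = nabla U V - nabla V U"
      using lc that unfolding levi_civita_connection_def by metis
    then show ?thesis
      using diff[OF nabla nabla vector_field_tangent] that by simp
  qed
  note t = XYZ[THEN vector_field_tangent, of p]
  show ?thesis
    using comp[of X Y Z] comp[of Y X Z] comp[of Z X Y] tors[of X Y Z] tors[of X Z Y] tors[of Y Z X] XYZ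
      sym[OF t(2) nabla, of X Z] sym[OF t(1) nabla, of Y Z] sym[OF t(1) nabla, of Z Y]
    by simp
qed

lemma riemannian_metric_linear:
  assumes "riemannian_metric A g" and T: "v \<in> tangent_space A p" "u \<in> tangent_space A p" "w \<in> tangent_space A p"
  shows "g p v w = g p w v"
    and "g p v (u + w) = g p v u + g p v w" "g p v (u - w) = g p v u - g p v w"
    and "g p v (a *\<^sub>R w) = a * g p v w" "g p v (- w) = - g p v w" "g p v 0 = 0"
    and "g p (u + w) v = g p u v + g p w v" "g p (u - w) v = g p u v - g p w v"
    and "g p (a *\<^sub>R w) v = a * g p w v" "g p (- w) v = - g p w v" "g p 0 v = 0"
proof -
  have sym: "g p v w = g p w v" if "v \<in> tangent_space A p" "w \<in> tangent_space A p" for v w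
    using assms(1) that unfolding riemannian_metric_def by blast
  have lin: "linear_over (tangent_space A p) (g p v)"
    using assms(1) T(1) unfolding riemannian_metric_def by blast
  note l = linear_over_tangent[OF lin T(2,3)] linear_over_tangent[OF lin T(3,3)]
  note c = T tangent_space_add[OF T(2,3)] tangent_space_diff[OF T(2,3)] tangent_space_scaleR[OF T(3)]
    tangent_space_uminus[OF T(3)] tangent_space_zero
  show "g p v w = g p w v"
    and "g p v (u + w) = g p v u + g p v w" "g p v (u - w) = g p v u - g p v w"
    and "g p v (a *\<^sub>R w) = a * g p v w" "g p v (- w) = - g p v w" "g p v 0 = 0"
    using sym[OF T(1,3)] l by simp_all
  then show "g p (u + w) v = g p u v + g p w v" "g p (u - w) v = g p u v - g p w v"
    and "g p (a *\<^sub>R w) v = a * g p w v" "g p (- w) v = - g p w v" "g p 0 v = 0"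
    using c by (metis sym)+
qed

lemma riemannian_metric_nonneg:
  assumes "riemannian_metric A g" "v \<in> tangent_space A p"
  shows "g p v v \<ge> 0" "g p v v = 0 \<Longrightarrow> v = 0"
proof -
  have pos: "v \<noteq> 0 \<Longrightarrow> g p v v > 0"
    using assms unfolding riemannian_metric_def by blast
  show "g p v v = 0 \<Longrightarrow> v = 0" using pos by force
  show "g p v v \<ge> 0"
    using pos riemannian_metric_linear(6)[OF assms assms(2,2)] by (cases "v = 0") auto
qed

lemma riemannian_metric_smooth:
  "\<lbrakk>riemannian_metric A g; X \<in> vector_fields A; Y \<in> vector_fields A\<rbrakk>
    \<Longrightarrow> (\<lambda>p. g p (X p) (Y p)) \<in> smooth_functions A"
  unfolding riemannian_metric_def by blast

lemma one_form_linear: "one_form A \<omega> \<Longrightarrow> linear_over (tangent_space A p) (\<omega> p)"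
  unfolding one_form_def by blast

lemma one_form_smooth:
  "\<lbrakk>one_form A \<omega>; X \<in> vector_fields A\<rbrakk> \<Longrightarrow> (\<lambda>p. \<omega> p (X p)) \<in> smooth_functions A"
  unfolding one_form_def by blast

lemma endomorphism_field_linear:
  "endomorphism_field A J \<Longrightarrow> linear_over (tangent_space A p) (J p)"
  unfolding endomorphism_field_def by blast

lemma endomorphism_field_vector_field:
  "\<lbrakk>endomorphism_field A J; X \<in> vector_fields A\<rbrakk> \<Longrightarrow> (\<lambda>p. J p (X p)) \<in> vector_fields A"
  unfolding endomorphism_field_def by blast

text \<open>Koszul's formula produces g_1(X, JY) through d\<omega>; this rewrites it as a pairing of
  -JX with Y, from which the first component of the connection can be read off.\<close>

lemma (in almost_hermitian_manifold) g_J_skew: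
  assumes X: "X \<in> vector_fields A" and Y: "Y \<in> vector_fields A"
  shows "g p (X p) (J p (Y p)) = - g p (J p (X p)) (Y p)"
proof -
  note t = vector_field_tangent
  have JX: "(\<lambda>p. J p (X p)) \<in> vector_fields A" and JY: "(\<lambda>p. J p (Y p)) \<in> vector_fields A"
    using endomorphism_field_vector_field[OF J] X Y by auto
  have "g p (X p) (J p (Y p)) = g p (J p (X p)) (J p (J p (Y p)))"
    using g_J_J[OF X JY] by simp
  also have "\<dots> = - g p (J p (X p)) (Y p)"
    using riemannian_metric_linear(5)[OF g t[OF JX] t[OF Y] t[OF Y], of p] J_J[OF Y] by simp
  finally show ?thesis .
qed

section \<open>Identities of a contact metric structure\<close>

context contact_metric_manifold
begin

lemma \<phi>_field: "U \<in> vector_fields A \<Longrightarrow> (\<lambda>p. \<phi> p (U p)) \<in> vector_fields A"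
  using endomorphism_field_vector_field[OF \<phi>] .

text \<open>Since \<phi>^2 \<xi> = 0, the formula for \<phi>^2 at \<phi>\<xi> shows \<phi>\<xi> = c
  \<xi>. Applying \<phi> once more gives c \<phi>\<xi> = 0, so either c = 0 or \<phi>\<xi> = 0, and
  both cases give the claim.\<close>

lemma \<phi>_\<xi>: "\<phi> p (\<xi> p) = 0"
proof -
  note lin = linear_over_tangent[OF endomorphism_field_linear[OF \<phi>]
      vector_field_tangent[OF \<xi>] vector_field_tangent[OF \<xi>]]
  let ?c = "\<eta> p (\<phi> p (\<xi> p))"
  have 2: "\<phi> p (\<phi> p (\<xi> p)) = 0"
    using \<phi>_\<phi>[OF \<xi>] \<eta>_\<xi> by simp
  then have c: "\<phi> p (\<xi> p) = ?c *\<^sub>R \<xi> p"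
    using \<phi>_\<phi>[OF \<phi>_field[OF \<xi>], of p] lin(5) by simp
  have "?c *\<^sub>R \<phi> p (\<xi> p) = 0"
    using 2 lin(3)[where a = ?c] by (metis c)
  then show ?thesis using c by force
qed

text \<open>Compute \<phi>^3 U in two ways, as \<phi> of \<phi>^2 U and as \<phi>^2 of \<phi>U. The
  results differ by \<eta>(\<phi>U) \<xi>, and \<xi> is nonzero because \<eta>(\<xi>) = 1.\<close>

lemma \<eta>_\<phi>:
  assumes U: "U \<in> vector_fields A" shows "\<eta> p (\<phi> p (U p)) = 0"
proof -
  note T = vector_field_tangent[OF U, of p] vector_field_tangent[OF \<xi>, of p]
  note lin = linear_over_tangent[OF endomorphism_field_linear[OF \<phi>]]
  have "\<phi> p (\<phi> p (\<phi> p (U p))) = - \<phi> p (U p) + \<eta> p (U p) *\<^sub>R \<phi> p (\<xi> p)"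
    using \<phi>_\<phi>[OF U, of p] lin(1)[OF tangent_space_uminus[OF T(1)] tangent_space_scaleR[OF T(2)]]
      lin(4)[OF T(1,1)] lin(3)[OF T(2,2)] by simp
  then have "\<eta> p (\<phi> p (U p)) *\<^sub>R \<xi> p = 0"
    using \<phi>_\<phi>[OF \<phi>_field[OF U], of p] \<phi>_\<xi> by simp
  moreover have "\<xi> p \<noteq> 0"
    using \<eta>_\<xi>[of p] linear_over_tangent(5)[OF one_form_linear[OF \<eta>] T(2,2)] by force
  ultimately show ?thesis by simp
qed

text \<open>This is metric compatibility for the pair \<xi>, U, whose left-hand side vanishes by
  \<open>\<phi>_\<xi>\<close>.\<close>

lemma g_\<xi>:
  assumes U: "U \<in> vector_fields A" shows "g p (\<xi> p) (U p) = \<eta> p (U p)"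
  using g_\<phi>_\<phi>[OF \<xi> U, of p] \<eta>_\<xi>[of p] \<phi>_\<xi>[of p]
    riemannian_metric_linear(11)[OF g, of "\<phi> p (U p)" p "\<phi> p (U p)" "\<phi> p (U p)"]
    vector_field_tangent[OF \<phi>_field[OF U], of p] by simp

text \<open>Metric compatibility for U and \<phi>V expresses g(U, \<phi>V) through \<phi>^2 V; the
  \<xi>-part of \<phi>^2 V is orthogonal to \<phi>U.\<close>

lemma g_\<phi>_skew:
  assumes U: "U \<in> vector_fields A" and V: "V \<in> vector_fields A"
  shows "g p (\<phi> p (U p)) (V p) = - g p (U p) (\<phi> p (V p))"
proof -
  note T = vector_field_tangent[OF \<phi>_field[OF U], of p] vector_field_tangent[OF V, of p]
    vector_field_tangent[OF \<xi>, of p]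
  have "g p (U p) (\<phi> p (V p)) = g p (\<phi> p (U p)) (- V p + \<eta> p (V p) *\<^sub>R \<xi> p)"
    using g_\<phi>_\<phi>[OF U \<phi>_field[OF V], of p] \<eta>_\<phi>[OF V] \<phi>_\<phi>[OF V, of p] by simp
  also have "\<dots> = - g p (\<phi> p (U p)) (V p) + \<eta> p (V p) * g p (\<phi> p (U p)) (\<xi> p)"
    using riemannian_metric_linear(2)[OF g T(1) tangent_space_uminus[OF T(2)] tangent_space_scaleR[OF T(3)]]
      riemannian_metric_linear(4)[OF g T(1,3,3)] riemannian_metric_linear(5)[OF g T(1,2,2)] by simp
  also have "g p (\<phi> p (U p)) (\<xi> p) = 0"
    using riemannian_metric_linear(1)[OF g T(1,3,3)] g_\<xi>[OF \<phi>_field[OF U]] \<eta>_\<phi>[OF U] by simp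
  finally show ?thesis by simp
qed

text \<open>The expression is the squared length of \<phi>U. It is the part of the product metric
  that is scaled by f^2.\<close>

lemma g_minus_\<eta>_nonneg:
  assumes U: "U \<in> vector_fields A" shows "g p (U p) (U p) - \<eta> p (U p) * \<eta> p (U p) \<ge> 0"
  using g_\<phi>_\<phi>[OF U U, of p] riemannian_metric_nonneg(1)[OF g vector_field_tangent[OF \<phi>_field[OF U]], of p]
  by simp

end

section \<open>Restriction to slices, and brackets of product fields\<close>

context product_manifold
begin

text \<open>Differentiating a pullback along \<open>N\<close> gives a smooth function on the
  product, and its restriction to a slice is smooth. This supplies fields on the factor whose value
  at the point in question is a component of \<open>N\<close>.\<close>

lemma fst_tvec_field:
  assumes "N \<in> vector_fields AB" shows "(\<lambda>p. fst_tvec A (N (p, q))) \<in> vector_fields A"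
proof -
  have "(\<lambda>p. N (p, q) (h \<circ> fst)) \<in> smooth_functions A" if "h \<in> smooth_functions A" for h
    using slice_fst[OF vector_field_smooth[OF assms comp_fst[OF that]], of q] by (simp add: o_def)
  then show ?thesis
    using fst_tvec_tangent[OF vector_field_tangent[OF assms]] A.smooth_const[of 0]
    unfolding vector_fields_def by (fastforce simp: fst_tvec_def)
qed

lemma snd_tvec_field:
  assumes "N \<in> vector_fields AB" shows "(\<lambda>q. snd_tvec B (N (p, q))) \<in> vector_fields B"
proof -
  have "(\<lambda>q. N (p, q) (h \<circ> snd)) \<in> smooth_functions B" if "h \<in> smooth_functions B" for h
    using slice_snd[OF vector_field_smooth[OF assms comp_snd[OF that]], of p] by (simp add: o_def)
  then show ?thesis
    using snd_tvec_tangent[OF vector_field_tangent[OF assms]] B.smooth_const[of 0]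
    unfolding vector_fields_def by (fastforce simp: snd_tvec_def)
qed

lemma pair_field_comp_fst:
  assumes "X \<in> vector_fields A" "U \<in> vector_fields B" "a \<in> smooth_functions A"
  shows "pair_field A B X U z (\<lambda>z. a (fst z)) = X (fst z) a"
  using comp_fst[OF assms(3)] B.tangent_const[OF vector_field_tangent[OF assms(2)]]
  by (cases z) (simp add: pair_field_def pair_tvec_apply)

lemma pair_field_comp_snd:
  assumes "X \<in> vector_fields A" "U \<in> vector_fields B" "b \<in> smooth_functions B"
  shows "pair_field A B X U z (\<lambda>z. b (snd z)) = U (snd z) b"
  using comp_snd[OF assms(3)] A.tangent_const[OF vector_field_tangent[OF assms(1)]]
  by (cases z) (simp add: pair_field_def pair_tvec_apply)

lemma pair_field_product:
  assumes "X \<in> vector_fields A" "U \<in> vector_fields B" "a \<in> smooth_functions A" "b \<in> smooth_functions B"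
  shows "pair_field A B X U (p, q) (\<lambda>z. a (fst z) * b (snd z)) = X p a * b q + a p * U q b"
  using pair_tvec_product[OF vector_field_tangent[OF assms(1)] vector_field_tangent[OF assms(2)] assms(3,4)]
  by (simp add: pair_field_def)

text \<open>The field (X, U) maps the pullback of \<open>h\<close> to the pullback of X[h], that is,
  it is related to X by the projection, and brackets of related fields are related.\<close>

lemma fst_lie_bracket:
  assumes X: "X \<in> vector_fields A" "Y \<in> vector_fields A" and U: "U \<in> vector_fields B" "V \<in> vector_fields B"
  shows "fst_tvec A (lie_bracket (pair_field A B X U) (pair_field A B Y V) (p, q)) = lie_bracket X Y p"
proof
  fix h
  show "fst_tvec A (lie_bracket (pair_field A B X U) (pair_field A B Y V) (p, q)) h = lie_bracket X Y p h"
  proof (cases "h \<in> smooth_functions A")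
    case True
    then show ?thesis
      using pair_field_comp_fst[OF X(1) U(1) True] pair_field_comp_fst[OF X(2) U(2) True]
        pair_field_comp_fst[OF X(1) U(1) vector_field_smooth[OF X(2) True]]
        pair_field_comp_fst[OF X(2) U(2) vector_field_smooth[OF X(1) True]]
      by (simp add: fst_tvec_def lie_bracket_def o_def)
  next
    case False
    \<comment> \<open>For \<open>h\<close> not smooth the inner functions of the bracket are
      constantly 0, and tangent vectors kill constants.\<close>
    then show ?thesis
      using tangent_space_outside[OF vector_field_tangent[OF X(1)] False]
        tangent_space_outside[OF vector_field_tangent[OF X(2)] False]
        A.tangent_const[OF vector_field_tangent[OF X(1)]] A.tangent_const[OF vector_field_tangent[OF X(2)]]
      by (simp add: fst_tvec_def lie_bracket_def)
  qed
qed

lemma snd_lie_bracket: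
  assumes X: "X \<in> vector_fields A" "Y \<in> vector_fields A" and U: "U \<in> vector_fields B" "V \<in> vector_fields B"
  shows "snd_tvec B (lie_bracket (pair_field A B X U) (pair_field A B Y V) (p, q)) = lie_bracket U V q"
proof
  fix h
  show "snd_tvec B (lie_bracket (pair_field A B X U) (pair_field A B Y V) (p, q)) h = lie_bracket U V q h"
  proof (cases "h \<in> smooth_functions B")
    case True
    then show ?thesis
      using pair_field_comp_snd[OF X(1) U(1) True] pair_field_comp_snd[OF X(2) U(2) True]
        pair_field_comp_snd[OF X(1) U(1) vector_field_smooth[OF U(2) True]]
        pair_field_comp_snd[OF X(2) U(2) vector_field_smooth[OF U(1) True]]
      by (simp add: snd_tvec_def lie_bracket_def o_def)
  next
    case False
    then show ?thesis
      using tangent_space_outside[OF vector_field_tangent[OF U(1)] False]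
        tangent_space_outside[OF vector_field_tangent[OF U(2)] False]
        B.tangent_const[OF vector_field_tangent[OF U(1)]] B.tangent_const[OF vector_field_tangent[OF U(2)]]
      by (simp add: snd_tvec_def lie_bracket_def)
  qed
qed

end

lemma (in smooth_manifold) lie_bracket_zero:
  assumes "X \<in> vector_fields A" shows "lie_bracket X 0 p = 0" "lie_bracket 0 X p = 0"
  using tangent_const[OF vector_field_tangent[OF assms], of p 0]
  by (auto simp: lie_bracket_def fun_eq_iff)

section \<open>Koszul's formula for horizontal and vertical fields\<close>

locale warped_contact_product = product_manifold A B + AH: almost_hermitian_manifold A J g\<^sub>1
    + CM: contact_metric_manifold B \<phi> \<xi> \<eta> g\<^sub>2
  for A :: "('a::{t2_space, second_countable_topology}, 'e::euclidean_space) atlas"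
    and B :: "('b::{t2_space, second_countable_topology}, 'f::euclidean_space) atlas"
    and J g\<^sub>1 \<phi> \<xi> \<eta> g\<^sub>2 +
  fixes \<omega> :: "'a \<Rightarrow> 'a tvec \<Rightarrow> real" and \<alpha> :: real and f :: "'a \<Rightarrow> real"
    and nabla :: "('a \<times> 'b \<Rightarrow> ('a \<times> 'b) tvec) \<Rightarrow> ('a \<times> 'b \<Rightarrow> ('a \<times> 'b) tvec)
              \<Rightarrow> ('a \<times> 'b \<Rightarrow> ('a \<times> 'b) tvec)"
  assumes \<omega>: "one_form A \<omega>"
    and d_\<omega>: "\<lbrakk>Y \<in> vector_fields A; Z \<in> vector_fields A\<rbrakk>
      \<Longrightarrow> ext_deriv \<omega> Y Z p = fundamental_form J g\<^sub>1 p (Y p) (Z p)"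
    and f: "f \<in> smooth_functions A" and f_pos: "f p > 0"
    and levi_civita: "levi_civita_connection AB (product_metric A B \<alpha> f \<omega> g\<^sub>1 \<eta> g\<^sub>2) nabla"
begin

abbreviation "G \<equiv> product_metric A B \<alpha> f \<omega> g\<^sub>1 \<eta> g\<^sub>2"

lemma G_eq: "G (p, q) u v =
    g\<^sub>1 p (fst_tvec A u) (fst_tvec A v)
    + (f p)\<^sup>2 * (g\<^sub>2 q (snd_tvec B u) (snd_tvec B v) - \<eta> q (snd_tvec B u) * \<eta> q (snd_tvec B v))
    + (\<alpha> * \<omega> p (fst_tvec A u) + \<eta> q (snd_tvec B u)) * (\<alpha> * \<omega> p (fst_tvec A v) + \<eta> q (snd_tvec B v))"
  by (simp add: product_metric_def eta_bar_def)

lemmas g\<^sub>1_linear = riemannian_metric_linear[OF AH.g]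
lemmas g\<^sub>2_linear = riemannian_metric_linear[OF CM.g]
lemmas \<omega>_linear = linear_over_tangent[OF one_form_linear[OF \<omega>]]
lemmas \<eta>_linear = linear_over_tangent[OF one_form_linear[OF CM.\<eta>]]

lemma components_tangent:
  assumes "u \<in> tangent_space AB (p, q)"
  shows "fst_tvec A u \<in> tangent_space A p" "snd_tvec B u \<in> tangent_space B q"
  using fst_tvec_tangent[OF assms] snd_tvec_tangent[OF assms] by simp_all

lemma G_sym:
  assumes "u \<in> tangent_space AB z" "v \<in> tangent_space AB z"
  shows "G z u v = G z v u"
proof (cases z)
  case (Pair p q)
  note T = components_tangent[OF assms(1)[unfolded Pair]] components_tangent[OF assms(2)[unfolded Pair]]
  show ?thesis
    unfolding Pair G_eq using g\<^sub>1_linear(1)[OF T(1,3,3)] g\<^sub>2_linear(1)[OF T(2,4,4)] by simp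
qed

lemma G_diff:
  assumes "u \<in> tangent_space AB z" "v \<in> tangent_space AB z" "w \<in> tangent_space AB z"
  shows "G z (u - v) w = G z u w - G z v w"
proof (cases z)
  case (Pair p q)
  note T = assms[unfolded Pair, THEN components_tangent(1)] assms[unfolded Pair, THEN components_tangent(2)]
  show ?thesis
    unfolding Pair G_eq fst_tvec_diff snd_tvec_diff
      g\<^sub>1_linear(8)[OF T(3,1,2)] g\<^sub>2_linear(8)[OF T(6,4,5)] \<omega>_linear(2)[OF T(1,2)] \<eta>_linear(2)[OF T(4,5)]
    by (simp add: algebra_simps)
qed

text \<open>The first argument is an arbitrary tangent vector because the values of the connection
  and of brackets, to which this is applied, are not given as pairs.\<close>

lemma G_pair_field_fst:
  assumes u: "u \<in> tangent_space AB (p, q)" and Y: "Y \<in> vector_fields A"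
  shows "G (p, q) u (pair_field A B Y 0 (p, q)) = g\<^sub>1 p (fst_tvec A u) (Y p)
    + (\<alpha> * \<omega> p (fst_tvec A u) + \<eta> q (snd_tvec B u)) * (\<alpha> * \<omega> p (Y p))"
  using components_tangent[OF u] vector_field_tangent[OF Y, of p] tangent_space_zero[of B q]
  by (simp add: G_eq pair_field_def fst_pair_tvec snd_pair_tvec g\<^sub>2_linear \<eta>_linear)

lemma G_pair_field_snd:
  assumes u: "u \<in> tangent_space AB (p, q)" and V: "V \<in> vector_fields B"
  shows "G (p, q) u (pair_field A B 0 V (p, q)) =
    (f p)\<^sup>2 * (g\<^sub>2 q (snd_tvec B u) (V q) - \<eta> q (snd_tvec B u) * \<eta> q (V q))
    + (\<alpha> * \<omega> p (fst_tvec A u) + \<eta> q (snd_tvec B u)) * \<eta> q (V q)"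
  using components_tangent[OF u] vector_field_tangent[OF V, of q] tangent_space_zero[of A p]
  by (simp add: G_eq pair_field_def fst_pair_tvec snd_pair_tvec g\<^sub>1_linear \<omega>_linear)

lemmas horizontal = pair_field_vector_field[OF _ B.vector_field_zero]
lemmas vertical = pair_field_vector_field[OF A.vector_field_zero]

lemma G_horizontal_horizontal:
  assumes "X \<in> vector_fields A" "Y \<in> vector_fields A"
  shows "G (p, q) (pair_field A B X 0 (p, q)) (pair_field A B Y 0 (p, q)) =
    g\<^sub>1 p (X p) (Y p) + \<alpha>\<^sup>2 * \<omega> p (X p) * \<omega> p (Y p)"
  using G_pair_field_fst[OF vector_field_tangent[OF horizontal[OF assms(1)]] assms(2)]
    vector_field_tangent[OF assms(1), of p] tangent_space_zero[of B q]
  by (simp add: pair_field_def fst_pair_tvec snd_pair_tvec \<eta>_linear power2_eq_square)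

lemma G_horizontal_vertical:
  assumes "X \<in> vector_fields A" "U \<in> vector_fields B"
  shows "G (p, q) (pair_field A B X 0 (p, q)) (pair_field A B 0 U (p, q)) = \<alpha> * \<omega> p (X p) * \<eta> q (U q)"
  using G_pair_field_snd[OF vector_field_tangent[OF horizontal[OF assms(1)]] assms(2)]
    vector_field_tangent[OF assms(1), of p] tangent_space_zero[of B q] vector_field_tangent[OF assms(2), of q]
  by (simp add: pair_field_def fst_pair_tvec snd_pair_tvec \<eta>_linear g\<^sub>2_linear)

lemma G_vertical_vertical:
  assumes "U \<in> vector_fields B" "V \<in> vector_fields B"
  shows "G (p, q) (pair_field A B 0 U (p, q)) (pair_field A B 0 V (p, q)) =
    (f p)\<^sup>2 * (g\<^sub>2 q (U q) (V q) - \<eta> q (U q) * \<eta> q (V q)) + \<eta> q (U q) * \<eta> q (V q)"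
  using G_pair_field_snd[OF vector_field_tangent[OF vertical[OF assms(1)]] assms(2)]
    vector_field_tangent[OF assms(1), of q] tangent_space_zero[of A p] vector_field_tangent[OF assms(2), of q]
  by (simp add: pair_field_def fst_pair_tvec snd_pair_tvec \<omega>_linear)

text \<open>Vanishing torsion presents the bracket as a difference of two vector fields, so the
  product rule for brackets follows from that of \<open>nabla\<close>.\<close>

lemma lie_bracket_tangent:
  assumes "X \<in> vector_fields AB" "Y \<in> vector_fields AB" shows "lie_bracket X Y p \<in> tangent_space AB p"
proof -
  have "nabla X Y - nabla Y X = lie_bracket X Y"
    using levi_civita assms unfolding levi_civita_connection_def by blast
  moreover have "nabla X Y \<in> vector_fields AB" "nabla Y X \<in> vector_fields AB"
    using levi_civita assms unfolding levi_civita_connection_def affine_connection_def by blast+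
  then have "(nabla X Y - nabla Y X) p \<in> tangent_space AB p"
    by (simp add: tangent_space_diff vector_field_tangent)
  ultimately show ?thesis by simp
qed

text \<open>Both components are brackets with the zero field, so \<open>tangent_prod_eq_0\<close>
  applies. The interchange of derivatives in the two factors is thereby obtained without computing
  mixed derivatives.\<close>

lemma lie_bracket_horizontal_vertical:
  assumes "X \<in> vector_fields A" "U \<in> vector_fields B"
  shows "lie_bracket (pair_field A B X 0) (pair_field A B 0 U) = 0"
proof -
  have "lie_bracket (pair_field A B X 0) (pair_field A B 0 U) (p, q) = 0" for p q
    using lie_bracket_tangent[OF horizontal[OF assms(1)] vertical[OF assms(2)]]
      fst_lie_bracket[OF assms(1) A.vector_field_zero B.vector_field_zero assms(2)]
      snd_lie_bracket[OF assms(1) A.vector_field_zero B.vector_field_zero assms(2)]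
      A.lie_bracket_zero[OF assms(1)] B.lie_bracket_zero[OF assms(2)]
    by (intro tangent_prod_eq_0) auto
  then show ?thesis by (auto simp: fun_eq_iff)
qed

lemma lie_bracket_vertical_horizontal:
  assumes "X \<in> vector_fields A" "U \<in> vector_fields B"
  shows "lie_bracket (pair_field A B 0 U) (pair_field A B X 0) = 0"
  using lie_bracket_horizontal_vertical[OF assms] by (simp add: lie_bracket_def fun_eq_iff)

lemma G_zero: "v \<in> tangent_space AB z \<Longrightarrow> G z 0 v = 0"
  using G_diff[of v z v v] by simp

lemma koszul:
  assumes "X \<in> vector_fields AB" "Y \<in> vector_fields AB" "Z \<in> vector_fields AB"
  shows "2 * G p (nabla X Y p) (Z p) =
    X p (\<lambda>q. G q (Y q) (Z q)) + Y p (\<lambda>q. G q (X q) (Z q)) - Z p (\<lambda>q. G q (X q) (Y q))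
    + G p (lie_bracket X Y p) (Z p) - G p (lie_bracket X Z p) (Y p) - G p (lie_bracket Y Z p) (X p)"
  by (rule koszul_formula[OF levi_civita _ _ assms]) (fact G_sym, fact G_diff)

lemma G_lie_bracket_mixed:
  assumes "X \<in> vector_fields A" "U \<in> vector_fields B" "Z \<in> vector_fields AB"
  shows "G z (lie_bracket (pair_field A B X 0) (pair_field A B 0 U) z) (Z z) = 0"
    and "G z (lie_bracket (pair_field A B 0 U) (pair_field A B X 0) z) (Z z) = 0"
  using lie_bracket_horizontal_vertical[OF assms(1,2)] lie_bracket_vertical_horizontal[OF assms(1,2)]
    G_zero[OF vector_field_tangent[OF assms(3)]] by simp_all

lemma smooth_pairing:
  assumes "X \<in> vector_fields A" "U \<in> vector_fields B"
  shows "(\<lambda>p. \<alpha> * \<omega> p (X p)) \<in> smooth_functions A" "(\<lambda>q. \<eta> q (U q)) \<in> smooth_functions B"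
  using one_form_smooth[OF \<omega> assms(1)] one_form_smooth[OF CM.\<eta> assms(2)]
  by (auto intro: A.smooth_mult A.smooth_const)

text \<open>The mixed brackets vanish, and so does the U-derivative of G(X, Y), a function on the
  first factor alone. The remaining terms carry the common factor \<alpha> \<eta>(U) and assemble to
  2 d\<omega>(X, Y).\<close>

lemma G_nabla_horizontal:
  assumes X: "X \<in> vector_fields A" and U: "U \<in> vector_fields B" and Y: "Y \<in> vector_fields A"
  shows "G (p, q) (nabla (pair_field A B X 0) (pair_field A B 0 U) (p, q)) (pair_field A B Y 0 (p, q))
    = \<alpha> * \<eta> q (U q) * g\<^sub>1 p (X p) (J p (Y p))"
proof -
  let ?X = "pair_field A B X 0" and ?U = "pair_field A B 0 U" and ?Y = "pair_field A B Y 0"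
  note tU = vector_field_tangent[OF U, of q]
  note s = smooth_pairing[OF X U] smooth_pairing[OF Y U] one_form_smooth[OF \<omega> X] one_form_smooth[OF \<omega> Y]
  have pf: "pair_field A B Z 0 (p, q) (\<lambda>z. G z (pair_field A B W 0 z) (?U z))
      = \<alpha> * Z p (\<lambda>p. \<omega> p (W p)) * \<eta> q (U q)"
    if Z: "Z \<in> vector_fields A" and W: "W \<in> vector_fields A" for Z W
  proof -
    have "(\<lambda>z. G z (pair_field A B W 0 z) (?U z)) = (\<lambda>z. (\<lambda>p. \<alpha> * \<omega> p (W p)) (fst z) * (\<lambda>q. \<eta> q (U q)) (snd z))"
      using G_horizontal_vertical[OF W U] by auto
    then have "pair_field A B Z 0 (p, q) (\<lambda>z. G z (pair_field A B W 0 z) (?U z))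
        = Z p (\<lambda>p. \<alpha> * \<omega> p (W p)) * \<eta> q (U q)"
      using pair_field_product[OF Z B.vector_field_zero smooth_pairing[OF W U], of p q] by simp
    moreover have "Z p (\<lambda>p. \<alpha> * \<omega> p (W p)) = \<alpha> * Z p (\<lambda>p. \<omega> p (W p))"
      using tangent_space_mult[OF vector_field_tangent[OF Z] A.smooth_const one_form_smooth[OF \<omega> W]]
        A.tangent_const[OF vector_field_tangent[OF Z]] by simp
    ultimately show ?thesis by simp
  qed
  have 1: "?X (p, q) (\<lambda>z. G z (?U z) (?Y z)) = \<alpha> * X p (\<lambda>p. \<omega> p (Y p)) * \<eta> q (U q)"
  proof -
    have "(\<lambda>z. G z (?U z) (?Y z)) = (\<lambda>z. G z (?Y z) (?U z))"
      using G_sym vector_field_tangent[OF vertical[OF U]] vector_field_tangent[OF horizontal[OF Y]] by blast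
    then show ?thesis using pf[OF X Y] by simp
  qed
  have 2: "?U (p, q) (\<lambda>z. G z (?X z) (?Y z)) = 0"
  proof -
    have "(\<lambda>z. G z (?X z) (?Y z)) = (\<lambda>z. (\<lambda>p. g\<^sub>1 p (X p) (Y p) + \<alpha>\<^sup>2 * \<omega> p (X p) * \<omega> p (Y p)) (fst z))"
      using G_horizontal_horizontal[OF X Y] by auto
    moreover have "(\<lambda>p. g\<^sub>1 p (X p) (Y p) + \<alpha>\<^sup>2 * \<omega> p (X p) * \<omega> p (Y p)) \<in> smooth_functions A"
      by (intro A.smooth_add A.smooth_mult A.smooth_const riemannian_metric_smooth[OF AH.g] X Y s)
    ultimately show ?thesis
      using pair_field_comp_fst[OF A.vector_field_zero U] by simp
  qed
  have 3: "?Y (p, q) (\<lambda>z. G z (?X z) (?U z)) = \<alpha> * Y p (\<lambda>p. \<omega> p (X p)) * \<eta> q (U q)"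
    using pf[OF Y X] .
  have 4: "G (p, q) (lie_bracket ?X ?Y (p, q)) (?U (p, q)) = \<alpha> * \<omega> p (lie_bracket X Y p) * \<eta> q (U q)"
    using G_pair_field_snd[OF lie_bracket_tangent[OF horizontal[OF X] horizontal[OF Y]] U]
      fst_lie_bracket[OF X Y B.vector_field_zero B.vector_field_zero]
      snd_lie_bracket[OF X Y B.vector_field_zero B.vector_field_zero]
      B.lie_bracket_zero[OF B.vector_field_zero] tU tangent_space_zero[of B q]
    by (simp add: g\<^sub>2_linear \<eta>_linear)
  have "2 * G (p, q) (nabla ?X ?U (p, q)) (?Y (p, q)) =
      \<alpha> * \<eta> q (U q) * (X p (\<lambda>p. \<omega> p (Y p)) - Y p (\<lambda>p. \<omega> p (X p)) - \<omega> p (lie_bracket X Y p))"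
    unfolding koszul[OF horizontal[OF X] vertical[OF U] horizontal[OF Y]] 1 2 3 4
      G_lie_bracket_mixed(1)[OF X U horizontal[OF Y]] G_lie_bracket_mixed(2)[OF Y U horizontal[OF X]]
    by algebra
  moreover have "X p (\<lambda>p. \<omega> p (Y p)) - Y p (\<lambda>p. \<omega> p (X p)) - \<omega> p (lie_bracket X Y p) = 2 * g\<^sub>1 p (X p) (J p (Y p))"
    using d_\<omega>[OF X Y, of p] by (simp add: ext_deriv_def fundamental_form_def)
  ultimately show ?thesis by simp
qed

text \<open>In G(U, V) only the factor f^2 varies along X, which gives the term with f X[f]. The
  other terms carry the common factor \<alpha> \<omega>(X) and assemble to 2 d\<eta>(U, V).\<close>

lemma G_nabla_vertical:
  assumes X: "X \<in> vector_fields A" and U: "U \<in> vector_fields B" and V: "V \<in> vector_fields B"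
  shows "G (p, q) (nabla (pair_field A B X 0) (pair_field A B 0 U) (p, q)) (pair_field A B 0 V (p, q))
    = f p * X p f * (g\<^sub>2 q (U q) (V q) - \<eta> q (U q) * \<eta> q (V q)) + \<alpha> * \<omega> p (X p) * g\<^sub>2 q (U q) (\<phi> q (V q))"
proof -
  let ?X = "pair_field A B X 0" and ?U = "pair_field A B 0 U" and ?V = "pair_field A B 0 V"
  note tX = vector_field_tangent[OF X, of p]
  note s = smooth_pairing[OF X U] smooth_pairing[OF X V]
  have pf: "pair_field A B 0 Z (p, q) (\<lambda>z. G z (?X z) (pair_field A B 0 W z)) = \<alpha> * \<omega> p (X p) * Z q (\<lambda>q. \<eta> q (W q))"
    if Z: "Z \<in> vector_fields B" and W: "W \<in> vector_fields B" for Z W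
  proof -
    have "(\<lambda>z. G z (?X z) (pair_field A B 0 W z)) = (\<lambda>z. (\<lambda>p. \<alpha> * \<omega> p (X p)) (fst z) * (\<lambda>q. \<eta> q (W q)) (snd z))"
      using G_horizontal_vertical[OF X W] by auto
    then show ?thesis
      using pair_field_product[OF A.vector_field_zero Z smooth_pairing[OF X W], of p q] by simp
  qed
  have 1: "?X (p, q) (\<lambda>z. G z (?U z) (?V z)) = 2 * f p * X p f * (g\<^sub>2 q (U q) (V q) - \<eta> q (U q) * \<eta> q (V q))"
  proof -
    let ?a = "\<lambda>p. f p * f p" and ?b = "\<lambda>q. g\<^sub>2 q (U q) (V q) - \<eta> q (U q) * \<eta> q (V q)"
      and ?c = "\<lambda>q. \<eta> q (U q) * \<eta> q (V q)"
    have a: "?a \<in> smooth_functions A" and c: "?c \<in> smooth_functions B" and b: "?b \<in> smooth_functions B"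
      using A.smooth_mult[OF f f] B.smooth_mult[OF s(2,4)]
        B.smooth_diff[OF riemannian_metric_smooth[OF CM.g U V] B.smooth_mult[OF s(2,4)]] by auto
    \<comment> \<open>Separation of variables: a function of the first factor times one of the
      second, plus one of the second, on which the horizontal field vanishes.\<close>
    have eq: "(\<lambda>z. G z (?U z) (?V z)) = (\<lambda>z. ?a (fst z) * ?b (snd z) + ?c (snd z))"
      using G_vertical_vertical[OF U V] by (auto simp: power2_eq_square)
    have "?X (p, q) (\<lambda>z. ?a (fst z) * ?b (snd z) + ?c (snd z))
        = ?X (p, q) (\<lambda>z. ?a (fst z) * ?b (snd z)) + ?X (p, q) (\<lambda>z. ?c (snd z))"
      by (rule AB.tangent_add[OF vector_field_tangent[OF horizontal[OF X]]
            AB.smooth_mult[OF comp_fst[OF a] comp_snd[OF b]] comp_snd[OF c]])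
    moreover have "?X (p, q) (\<lambda>z. ?a (fst z) * ?b (snd z)) = X p ?a * ?b q"
      using pair_field_product[OF X B.vector_field_zero a b, of p q] by simp
    moreover have "?X (p, q) (\<lambda>z. ?c (snd z)) = 0"
      using pair_field_comp_snd[OF X B.vector_field_zero c] by simp
    moreover have "X p ?a = 2 * f p * X p f"
      using tangent_space_mult[OF tX f f] by simp
    ultimately show ?thesis unfolding eq by simp
  qed
  have 2: "?U (p, q) (\<lambda>z. G z (?X z) (?V z)) = \<alpha> * \<omega> p (X p) * U q (\<lambda>q. \<eta> q (V q))"
    using pf[OF U V] .
  have 3: "?V (p, q) (\<lambda>z. G z (?X z) (?U z)) = \<alpha> * \<omega> p (X p) * V q (\<lambda>q. \<eta> q (U q))"
    using pf[OF V U] .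
  have 4: "G (p, q) (lie_bracket ?U ?V (p, q)) (?X (p, q)) = \<alpha> * \<omega> p (X p) * \<eta> q (lie_bracket U V q)"
    using G_pair_field_fst[OF lie_bracket_tangent[OF vertical[OF U] vertical[OF V]] X]
      fst_lie_bracket[OF A.vector_field_zero A.vector_field_zero U V]
      snd_lie_bracket[OF A.vector_field_zero A.vector_field_zero U V]
      A.lie_bracket_zero[OF A.vector_field_zero] tX tangent_space_zero[of A p]
    by (simp add: g\<^sub>1_linear \<omega>_linear)
  have "2 * G (p, q) (nabla ?X ?U (p, q)) (?V (p, q)) =
      2 * f p * X p f * (g\<^sub>2 q (U q) (V q) - \<eta> q (U q) * \<eta> q (V q)) +
      \<alpha> * \<omega> p (X p) * (U q (\<lambda>q. \<eta> q (V q)) - V q (\<lambda>q. \<eta> q (U q)) - \<eta> q (lie_bracket U V q))"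
    unfolding koszul[OF horizontal[OF X] vertical[OF U] vertical[OF V]] 1 2 3 4
      G_lie_bracket_mixed(1)[OF X U vertical[OF V]] G_lie_bracket_mixed(1)[OF X V vertical[OF U]]
    by algebra
  moreover have "U q (\<lambda>q. \<eta> q (V q)) - V q (\<lambda>q. \<eta> q (U q)) - \<eta> q (lie_bracket U V q) = 2 * g\<^sub>2 q (U q) (\<phi> q (V q))"
    using CM.d_\<eta>[OF U V, of q] by (simp add: ext_deriv_def)
  ultimately show ?thesis by simp
qed

text \<open>Let Y and V be the components of the difference from the claimed value and s its
  \<eta>bar. Koszul's formula tested against Y and V gives g_1(Y, Y) = -s \<alpha> \<omega>(Y) and
  f^2 (g_2(V, V) - \<eta>(V)^2) = -s \<eta>(V). The right-hand sides add up to -s^2 while the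
  left-hand sides are nonnegative, so s = 0; then Y and V vanish in turn.\<close>

lemma nabla_horizontal_vertical:
  assumes X: "X \<in> vector_fields A" and U: "U \<in> vector_fields B"
  shows "nabla (pair_field A B X 0) (pair_field A B 0 U) (p, q) =
    pair_tvec A B (p, q)
      (- (\<alpha> * \<eta> q (U q)) *\<^sub>R J p (X p))
      (- (X p f / f p) *\<^sub>R \<phi> q (\<phi> q (U q))
        - (\<alpha> / (f p)\<^sup>2 * \<omega> p (X p)) *\<^sub>R \<phi> q (U q)
        + (\<alpha>\<^sup>2 * \<eta> q (U q) * \<omega> p (J p (X p))) *\<^sub>R \<xi> q)"
proof -
  let ?N = "nabla (pair_field A B X 0) (pair_field A B 0 U)"
  \<comment> \<open>The coefficients are frozen at (p, q). Hence \<open>C\<close> and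
    \<open>E\<close> are combinations of vector fields of the factors with constant coefficients,
    and they have the claimed values at \<open>p\<close> and \<open>q\<close>, the only points where
    this matters.\<close>
  define k where "k = - (X p f / f p)"
  define l where "l = - (\<alpha> / (f p)\<^sup>2 * \<omega> p (X p))"
  define m where "m = \<alpha>\<^sup>2 * \<eta> q (U q) * \<omega> p (J p (X p))"
  define C where "C p' = - (\<alpha> * \<eta> q (U q)) *\<^sub>R J p' (X p')" for p'
  define E where "E q' = k *\<^sub>R \<phi> q' (\<phi> q' (U q')) + l *\<^sub>R \<phi> q' (U q') + m *\<^sub>R \<xi> q'" for q'
  have N: "?N \<in> vector_fields AB"
    using levi_civita horizontal[OF X] vertical[OF U]
    unfolding levi_civita_connection_def affine_connection_def by blast
  have JX: "(\<lambda>p. J p (X p)) \<in> vector_fields A"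
    using endomorphism_field_vector_field[OF AH.J X] .
  have \<phi>U: "(\<lambda>q. \<phi> q (U q)) \<in> vector_fields B"
    using CM.\<phi>_field[OF U] .
  have \<phi>\<phi>U: "(\<lambda>q. \<phi> q (\<phi> q (U q))) \<in> vector_fields B"
    using CM.\<phi>_field[OF \<phi>U] .
  have C: "C \<in> vector_fields A"
    using A.vector_field_lincomb[OF JX JX, of "- (\<alpha> * \<eta> q (U q))" 0] by (simp add: C_def[abs_def])
  have E: "E \<in> vector_fields B"
    using B.vector_field_lincomb[OF B.vector_field_lincomb[OF \<phi>\<phi>U \<phi>U, of k l] CM.\<xi>, of 1 m]
    by (simp add: E_def[abs_def])
  \<comment> \<open>The test fields: at \<open>p\<close> and \<open>q\<close> they are the
    components of the difference itself, so each pairing below contains its squared length.\<close>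
  define Y where "Y p' = fst_tvec A (?N (p', q)) - C p'" for p'
  define V where "V q' = snd_tvec B (?N (p, q')) - E q'" for q'
  have Y: "Y \<in> vector_fields A"
    using A.vector_field_lincomb[OF fst_tvec_field[OF N, of q] C, of 1 "- 1"] by (simp add: Y_def[abs_def])
  have V: "V \<in> vector_fields B"
    using B.vector_field_lincomb[OF snd_tvec_field[OF N, of p] E, of 1 "- 1"] by (simp add: V_def[abs_def])
  note tA = C[THEN vector_field_tangent, of p] Y[THEN vector_field_tangent, of p] JX[THEN vector_field_tangent, of p]
  note tB = E[THEN vector_field_tangent, of q] V[THEN vector_field_tangent, of q]
    \<phi>U[THEN vector_field_tangent, of q] \<phi>\<phi>U[THEN vector_field_tangent, of q] CM.\<xi>[THEN vector_field_tangent, of q]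
    U[THEN vector_field_tangent, of q]
  define s where "s = \<alpha> * \<omega> p (Y p) + \<eta> q (V q)"
  have \<omega>C: "\<omega> p (C p) = - (\<alpha> * \<eta> q (U q)) * \<omega> p (J p (X p))"
    unfolding C_def \<omega>_linear(3)[OF tA(3,3)] by simp
  have "\<eta> q (E q) = k * \<eta> q (\<phi> q (\<phi> q (U q))) + l * \<eta> q (\<phi> q (U q)) + m * \<eta> q (\<xi> q)"
    unfolding E_def using tB
    by (simp add: \<eta>_linear(1) \<eta>_linear(3)[of _ q 0] tangent_space_add tangent_space_scaleR tangent_space_zero)
  then have \<eta>E: "\<eta> q (E q) = m"
    using CM.\<eta>_\<phi>[OF \<phi>U] CM.\<eta>_\<phi>[OF U] CM.\<eta>_\<xi> by simp
  have n: "fst_tvec A (?N (p, q)) = Y p + C p" "snd_tvec B (?N (p, q)) = V q + E q"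
    by (auto simp: Y_def V_def)
  \<comment> \<open>The value \<eta>bar of \<open>?N\<close> equals that of the difference, because
    \<open>m\<close> is chosen to cancel \<alpha> \<omega>(C).\<close>
  have sN: "\<alpha> * \<omega> p (fst_tvec A (?N (p, q))) + \<eta> q (snd_tvec B (?N (p, q))) = s"
    unfolding n \<omega>_linear(1)[OF tA(2,1)] \<eta>_linear(1)[OF tB(2,1)] \<omega>C \<eta>E s_def m_def
    by (simp add: algebra_simps power2_eq_square)
  have "g\<^sub>1 p (C p) (Y p) = - (\<alpha> * \<eta> q (U q)) * g\<^sub>1 p (J p (X p)) (Y p)"
    unfolding C_def g\<^sub>1_linear(9)[OF tA(2,3,3)] by simp
  \<comment> \<open>By skewness of \<open>J\<close>, the right-hand side of
    \<open>G_nabla_horizontal\<close> equals g_1(C, Y). Splitting the first component of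
    \<open>?N\<close> as Y + C cancels it.\<close>
  then have 1: "g\<^sub>1 p (Y p) (Y p) = - s * \<alpha> * \<omega> p (Y p)"
    using G_nabla_horizontal[OF X U Y, of p q] AH.g_J_skew[OF X Y, of p]
    unfolding G_pair_field_fst[OF vector_field_tangent[OF N] Y] sN
    unfolding n g\<^sub>1_linear(7)[OF tA(2,2,1)] by (simp add: algebra_simps)
  have "g\<^sub>2 q (E q) (V q) = k * g\<^sub>2 q (\<phi> q (\<phi> q (U q))) (V q) + l * g\<^sub>2 q (\<phi> q (U q)) (V q) + m * g\<^sub>2 q (\<xi> q) (V q)"
    unfolding E_def using tB
    by (simp add: g\<^sub>2_linear(7) g\<^sub>2_linear(9)[of _ q 0] tangent_space_add tangent_space_scaleR tangent_space_zero)
  moreover have "g\<^sub>2 q (\<phi> q (\<phi> q (U q))) (V q) = - (g\<^sub>2 q (U q) (V q) - \<eta> q (U q) * \<eta> q (V q))"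
    using CM.g_\<phi>_skew[OF \<phi>U V, of q] CM.g_\<phi>_\<phi>[OF U V, of q] by simp
  moreover have "g\<^sub>2 q (\<xi> q) (V q) = \<eta> q (V q)"
    using CM.g_\<xi>[OF V] .
  \<comment> \<open>Moving \<phi> to the other argument costs a sign for both \<phi>^2 and \<phi>,
    which accounts for the minus signs in \<open>k\<close> and \<open>l\<close>; the \<xi>-part of
    \<open>E\<close> drops out.\<close>
  ultimately have gE: "g\<^sub>2 q (E q) (V q) - m * \<eta> q (V q) =
      - k * (g\<^sub>2 q (U q) (V q) - \<eta> q (U q) * \<eta> q (V q)) - l * g\<^sub>2 q (U q) (\<phi> q (V q))"
    using CM.g_\<phi>_skew[OF U V, of q] by (simp add: algebra_simps)
  have kl: "(f p)\<^sup>2 * k = - (f p * X p f)" "(f p)\<^sup>2 * l = - (\<alpha> * \<omega> p (X p))"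
    using f_pos[of p] by (auto simp: k_def l_def power2_eq_square)
  have "(f p)\<^sup>2 * (g\<^sub>2 q (E q) (V q) - m * \<eta> q (V q)) =
      - ((f p)\<^sup>2 * k) * (g\<^sub>2 q (U q) (V q) - \<eta> q (U q) * \<eta> q (V q)) - ((f p)\<^sup>2 * l) * g\<^sub>2 q (U q) (\<phi> q (V q))"
    unfolding gE by algebra
  \<comment> \<open>As in the horizontal case, \<open>E\<close> accounts for exactly the right-hand
    side of \<open>G_nabla_vertical\<close>, once the denominators in \<open>k\<close> and
    \<open>l\<close> have cancelled against f^2.\<close>
  then have 2: "(f p)\<^sup>2 * (g\<^sub>2 q (V q) (V q) - \<eta> q (V q) * \<eta> q (V q)) = - s * \<eta> q (V q)"
    using G_nabla_vertical[OF X U V, of p q]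
    unfolding G_pair_field_snd[OF vector_field_tangent[OF N] V] sN kl
    unfolding n g\<^sub>2_linear(7)[OF tB(2,2,1)] \<eta>_linear(1)[OF tB(2,1)] \<eta>E by (simp add: algebra_simps)
  have nn: "g\<^sub>1 p (Y p) (Y p) \<ge> 0" "(f p)\<^sup>2 * (g\<^sub>2 q (V q) (V q) - \<eta> q (V q) * \<eta> q (V q)) \<ge> 0"
    using riemannian_metric_nonneg(1)[OF AH.g tA(2)] CM.g_minus_\<eta>_nonneg[OF V] by auto
  have "g\<^sub>1 p (Y p) (Y p) + (f p)\<^sup>2 * (g\<^sub>2 q (V q) (V q) - \<eta> q (V q) * \<eta> q (V q)) = - s\<^sup>2"
    unfolding 1 2 s_def by (simp add: algebra_simps power2_eq_square)
  then have "s\<^sup>2 \<le> 0" using nn by linarith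
  then have s: "s = 0" by simp
  then have Yp: "Y p = 0"
    using riemannian_metric_nonneg(2)[OF AH.g tA(2)] 1 by simp
  \<comment> \<open>With Y = 0 the equation s = 0 reads \<eta>(V) = 0. This is needed because g_2(V,
    V) - \<eta>(V)^2 alone does not see multiples of \<xi>.\<close>
  then have \<eta>V: "\<eta> q (V q) = 0"
    using s \<omega>_linear(5)[OF tA(2,2)] by (simp add: s_def)
  then have Vq: "V q = 0"
    using riemannian_metric_nonneg(2)[OF CM.g tB(2)] 2 f_pos[of p] by simp
  have "?N (p, q) - pair_tvec A B (p, q) (C p) (E q) = 0"
  proof (rule tangent_prod_eq_0)
    show "?N (p, q) - pair_tvec A B (p, q) (C p) (E q) \<in> tangent_space AB (p, q)"
      using tangent_space_diff[OF vector_field_tangent[OF N] pair_tvec_tangent[OF tA(1) tB(1)]] .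
  qed (use Yp Vq n in \<open>auto simp: fst_tvec_diff snd_tvec_diff fst_pair_tvec[OF tA(1) tB(1)] snd_pair_tvec[OF tA(1) tB(1)]\<close>)
  then show ?thesis
    by (simp add: C_def E_def k_def l_def m_def)
qed

lemma nabla_horizontal_vertical_commute:
  assumes "X \<in> vector_fields A" "U \<in> vector_fields B"
  shows "nabla (pair_field A B X 0) (pair_field A B 0 U) = nabla (pair_field A B 0 U) (pair_field A B X 0)"
proof -
  have "nabla (pair_field A B X 0) (pair_field A B 0 U) - nabla (pair_field A B 0 U) (pair_field A B X 0) = 0"
    using levi_civita horizontal[OF assms(1)] vertical[OF assms(2)] lie_bracket_horizontal_vertical[OF assms]
    unfolding levi_civita_connection_def by simp
  then show ?thesis by simp
qed

end

theorem theorem4p3: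
  fixes A :: "('a::{t2_space, second_countable_topology}, 'e::euclidean_space) atlas"
    and B :: "('b::{t2_space, second_countable_topology}, 'f::euclidean_space) atlas"
    and J :: "'a \<Rightarrow> 'a tvec \<Rightarrow> 'a tvec" and g\<^sub>1 :: "'a \<Rightarrow> 'a tvec \<Rightarrow> 'a tvec \<Rightarrow> real"
    and \<omega> :: "'a \<Rightarrow> 'a tvec \<Rightarrow> real"
    and \<phi> :: "'b \<Rightarrow> 'b tvec \<Rightarrow> 'b tvec" and \<xi> :: "'b \<Rightarrow> 'b tvec"
    and \<eta> :: "'b \<Rightarrow> 'b tvec \<Rightarrow> real" and g\<^sub>2 :: "'b \<Rightarrow> 'b tvec \<Rightarrow> 'b tvec \<Rightarrow> real"
    and \<alpha> :: real and f :: "'a \<Rightarrow> real"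
    and nabla :: "('a \<times> 'b \<Rightarrow> ('a \<times> 'b) tvec) \<Rightarrow> ('a \<times> 'b \<Rightarrow> ('a \<times> 'b) tvec)
              \<Rightarrow> ('a \<times> 'b \<Rightarrow> ('a \<times> 'b) tvec)"
    and X :: "'a \<Rightarrow> 'a tvec" and U :: "'b \<Rightarrow> 'b tvec"
  assumes "almost_hermitian_manifold A J g\<^sub>1"
    and "one_form A \<omega>"
    and "\<And>Y Z p. \<lbrakk>Y \<in> vector_fields A; Z \<in> vector_fields A\<rbrakk>
           \<Longrightarrow> ext_deriv \<omega> Y Z p = fundamental_form J g\<^sub>1 p (Y p) (Z p)"
    and "contact_metric_manifold B \<phi> \<xi> \<eta> g\<^sub>2"
    and "f \<in> smooth_functions A"
    and "\<And>p. f p > 0"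
    and "levi_civita_connection (prod_atlas A B) (product_metric A B \<alpha> f \<omega> g\<^sub>1 \<eta> g\<^sub>2) nabla"
    and "X \<in> vector_fields A"
    and "U \<in> vector_fields B"
  shows "nabla (pair_field A B X 0) (pair_field A B 0 U) = nabla (pair_field A B 0 U) (pair_field A B X 0)
    \<and> nabla (pair_field A B 0 U) (pair_field A B X 0) =
        (\<lambda>(p, q). pair_tvec A B (p, q)
           (- (\<alpha> * \<eta> q (U q)) *\<^sub>R J p (X p))
           (- (X p f / f p) *\<^sub>R \<phi> q (\<phi> q (U q))
            - (\<alpha> / (f p)\<^sup>2 * \<omega> p (X p)) *\<^sub>R \<phi> q (U q)
            + (\<alpha>\<^sup>2 * \<eta> q (U q) * \<omega> p (J p (X p))) *\<^sub>R \<xi> q))"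
proof -
  interpret AH: almost_hermitian_manifold A J g\<^sub>1 by fact
  interpret CM: contact_metric_manifold B \<phi> \<xi> \<eta> g\<^sub>2 by fact
  interpret warped_contact_product A B J g\<^sub>1 \<phi> \<xi> \<eta> g\<^sub>2 \<omega> \<alpha> f nabla
    by unfold_locales (use assms in auto)
  have "nabla (pair_field A B X 0) (pair_field A B 0 U) =
      (\<lambda>(p, q). pair_tvec A B (p, q)
           (- (\<alpha> * \<eta> q (U q)) *\<^sub>R J p (X p))
           (- (X p f / f p) *\<^sub>R \<phi> q (\<phi> q (U q))
            - (\<alpha> / (f p)\<^sup>2 * \<omega> p (X p)) *\<^sub>R \<phi> q (U q)
            + (\<alpha>\<^sup>2 * \<eta> q (U q) * \<omega> p (J p (X p))) *\<^sub>R \<xi> q))"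
    using nabla_horizontal_vertical[OF assms(8,9)] by (intro ext) (simp add: split_paired_all)
  then show ?thesis
    using nabla_horizontal_vertical_commute[OF assms(8,9)] by simp
qed

end
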